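(* Let $\mathfrak{o}$ be a Dedekind domain, let $n$ be a positive integer, and let $\mathfrak{a}_1,\ldots,\mathfrak{a}_n$ and $\mathfrak{b}_1,\ldots,\mathfrak{b}_n$ be ideals in $\mathfrak{o}$ such that there exist matrices $A, B \in I_n$ with $\mathfrak{d}_k(A)=\mathfrak{a}_k$ and $\mathfrak{d}_k(B)=\mathfrak{b}_k$ for all $1\le k\le n$. Then there exist matrices $\tilde{A},\tilde{B} \in I_n$ satisfying $\mathfrak{d}_k(\tilde{A})=\mathfrak{a}_k$, $\mathfrak{d}_k(\tilde{B})=\mathfrak{b}_k$ and $\mathfrak{d}_k(\tilde{A}\tilde{B})=\mathfrak{a}_k\mathfrak{b}_k$ for all $1\le k\le n$.
   Context: $I_n$ denotes the set of $n \times n$ matrices with entries in $\mathfrak{o}$ and non-zero determinant. For $A \in \mathfrak{o}^{n\times n}$ and $1 \le k \le n$, the $k$-th determinantal divisor $\mathfrak{d}_k(A)$ is the ideal of $\mathfrak{o}$ generated by all $k\times k$ minors of $A$ (their ideal-theoretic g.c.d.). *)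

theory Defs
  imports
    "HOL-Algebra.Ideal_Product"
    "HOL-Algebra.Ring_Divisibility"
    "Jordan_Normal_Form.VS_Connect"
    "Jordan_Normal_Form.DL_Submatrix"
begin

text \<open>
  A ring is a type of class \<^class>\<open>idom\<close>; ideals are taken in \<^const>\<open>class_ring\<close>, the
  HOL-Algebra record of its operations, whose carrier is \<^term>\<open>UNIV\<close>.
\<close>

definition integrally_closed_domain :: "'a::idom itself \<Rightarrow> bool" where
  "integrally_closed_domain _ \<longleftrightarrow>
     (\<forall>x :: 'a fract.
        (\<exists>p :: 'a Polynomial.poly.
            Polynomial.lead_coeff p = 1 \<and> Polynomial.poly (map_poly to_fract p) x = 0)
        \<longrightarrow> x \<in> range to_fract)"

text \<open>
  Noetherian, integrally closed, and of Krull dimension at most one. Fields are included.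
\<close>

definition dedekind_domain :: "'a::idom itself \<Rightarrow> bool" where
  "dedekind_domain T \<longleftrightarrow>
     noetherian_domain (class_ring :: 'a ring) \<and>
     integrally_closed_domain T \<and>
     (\<forall>P :: 'a set. primeideal P class_ring \<and> P \<noteq> {0} \<longrightarrow> maximalideal P class_ring)"

definition nonsingular_mats :: "nat \<Rightarrow> 'a::idom mat set" where
  "nonsingular_mats n = {A \<in> carrier_mat n n. det A \<noteq> 0}"

definition det_divisor :: "nat \<Rightarrow> 'a::idom mat \<Rightarrow> 'a set" where
  "det_divisor k A =
     genideal class_ring
       {det (submatrix A I J) | I J.
          I \<subseteq> {..<dim_row A} \<and> J \<subseteq> {..<dim_col A} \<and> card I = k \<and> card J = k}"

end

theory Submission
  imports Defs "Jordan_Normal_Form.Char_Poly"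
begin

text \<open>
  Multiplying \<open>A\<close> on the right by some \<open>V\<close> with \<open>det V = 1\<close> changes no determinantal divisor, so it
  is enough to find \<open>V\<close> for which \<open>d_k(A V B) = d_k(A) d_k(B)\<close> for all \<open>k\<close>; then \<open>A V\<close> and \<open>B\<close> are the
  required matrices. Two ideals are equal as soon as they agree in the local ring at every maximal
  ideal \<open>P\<close> (\<open>local_global\<close>).

  If \<open>P\<close> does not contain \<open>det A * det B\<close>, then all three ideals contain a unit of the local ring,
  whatever \<open>V\<close> is (\<open>det_power_in_det_divisor\<close>). Only finitely many \<open>P\<close> are left
  (\<open>finite_maximal_ideals_containing\<close>), and each of them is nonzero, so divisibility in its local
  ring is a total preorder (\<open>ldvd_total\<close>). Gaussian elimination with pivots that are least in this
  preorder then yields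
  \<open>X A Y = diag(D) \<tau>\<close> and, from the transpose of \<open>B\<close>, \<open>Z B X' = \<sigma> diag(E)\<close>,
  where \<open>det X\<close> and \<open>det X'\<close> are not in \<open>P\<close>, the matrices \<open>\<tau>\<close> and \<open>\<sigma>\<close> are modulo \<open>P\<close> diagonal with
  invertible diagonal, and \<open>D\<close> and \<open>E\<close> are divisibility chains (\<open>local_smith_form\<close>).
  If \<open>V\<close> is congruent to \<open>Y Z\<close> modulo \<open>P\<close>, then \<open>V = Y \<Theta> Z\<close> with \<open>\<Theta>\<close> congruent to the identity, so
  \<open>X (A V B) X' = diag(D) (\<tau> \<Theta> \<sigma>) diag(E)\<close>,
  and \<open>\<tau> \<Theta> \<sigma>\<close> is again diagonal modulo \<open>P\<close>. Because both chains start with their smallest terms, the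
  \<open>k\<close>-th determinantal divisor of this matrix is locally generated by its leading minor, that is by
  \<open>D_1 ... D_k E_1 ... E_k\<close>, while those of \<open>A\<close> and \<open>B\<close> are locally generated by \<open>D_1 ... D_k\<close> and
  \<open>E_1 ... E_k\<close> (\<open>det_divisor_local\<close>).

  It remains to realise finitely many congruences \<open>V = Y_P Z_P\<close> modulo \<open>P\<close> by one \<open>V\<close> of determinant
  one. In the elimination, \<open>Y\<close> and \<open>Z\<close> are built from shears, and a shear deforms to the identity inside
  the matrices of determinant one by scaling its off-diagonal part with a parameter. Inserting
  idempotents of the Chinese remainder theorem for the parameter solves the congruences
  (\<open>sl_path_simultaneous\<close>).
\<close>

section \<open>Ideals of a noetherian domain\<close>

text \<open>
  Ideals as plain subsets of the ring type, so that computations with their elements stay in the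
  type class; \<open>ideal_class_ring_iff\<close> identifies them with the ideals of the record of operations.
\<close>

definition is_ideal :: "'a::comm_ring_1 set \<Rightarrow> bool" where
  "is_ideal I \<longleftrightarrow> 0 \<in> I \<and> (\<forall>x\<in>I. \<forall>y\<in>I. x + y \<in> I) \<and> (\<forall>r. \<forall>x\<in>I. r * x \<in> I)"

lemma is_idealD:
  assumes "is_ideal I"
  shows ideal_zero: "0 \<in> I"
    and ideal_add: "\<And>x y. x \<in> I \<Longrightarrow> y \<in> I \<Longrightarrow> x + y \<in> I"
    and ideal_mult_left: "\<And>r x. x \<in> I \<Longrightarrow> r * x \<in> I"
    and ideal_mult_right: "\<And>r x. x \<in> I \<Longrightarrow> x * r \<in> I"
  using assms by (auto simp: is_ideal_def mult.commute)

lemma ideal_uminus: "is_ideal I \<Longrightarrow> x \<in> I \<Longrightarrow> - x \<in> I"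
  using ideal_mult_left[of I x "-1"] by simp

lemma ideal_diff: "is_ideal I \<Longrightarrow> x \<in> I \<Longrightarrow> y \<in> I \<Longrightarrow> x - y \<in> I"
  using ideal_add[of I x "- y"] ideal_uminus[of I y] by simp

lemma ideal_add_cancel:
  assumes "is_ideal I" "x + y \<in> I" "y \<in> I"
  shows "x \<in> I"
  using ideal_diff[OF assms] by simp

lemma ideal_sum: "is_ideal I \<Longrightarrow> (\<And>i. i \<in> F \<Longrightarrow> f i \<in> I) \<Longrightarrow> sum f F \<in> I"
  by (induction F rule: infinite_finite_induct) (auto simp: ideal_zero ideal_add)

lemma ideal_class_ring_iff: "ideal I class_ring \<longleftrightarrow> is_ideal I"
proof
  assume "ideal I class_ring"
  then interpret ideal I class_ring .
  show "is_ideal I"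
    unfolding is_ideal_def
    using zero_closed a_closed I_l_closed by auto
next
  assume I: "is_ideal I"
  show "ideal I class_ring"
  proof (rule idealI)
    show "ring (class_ring :: 'a ring)" by (rule class_ring.ring_axioms)
    have grp: "Group.group (add_monoid (class_ring :: 'a ring))"
      by (rule abelian_group.a_group[OF ring.is_abelian_group]) (rule class_ring.ring_axioms)
    have inv: "inv\<^bsub>add_monoid (class_ring :: 'a ring)\<^esub> x = - x" for x
      using fun_cong[OF class_ring_simps(8), of x] unfolding a_inv_def .
    show "subgroup I (add_monoid class_ring)"
      by (rule group.subgroupI[OF grp], unfold inv)
        (use ideal_zero[OF I] in \<open>auto simp: ideal_add[OF I] ideal_uminus[OF I]\<close>)
  qed (simp_all add: ideal_mult_left[OF I] ideal_mult_right[OF I])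
qed

lemma genideal_class_ring:
  "genideal class_ring S = \<Inter>{I. is_ideal I \<and> S \<subseteq> I}"
  by (simp add: genideal_def ideal_class_ring_iff)

definition adjoin :: "'a::comm_ring_1 set \<Rightarrow> 'a \<Rightarrow> 'a set" where
  "adjoin I x = {i + r * x | i r. i \<in> I}"

lemma adjoin_ideal:
  assumes I: "is_ideal I"
  shows "is_ideal (adjoin I x)" "I \<subseteq> adjoin I x" "x \<in> adjoin I x"
proof -
  show "I \<subseteq> adjoin I x"
  proof
    fix i assume "i \<in> I"
    thus "i \<in> adjoin I x"
      unfolding adjoin_def mem_Collect_eq by (intro exI[of _ i] exI[of _ 0]) simp
  qed
  show "x \<in> adjoin I x"
    unfolding adjoin_def mem_Collect_eq using ideal_zero[OF I]
    by (intro exI[of _ 0] exI[of _ 1]) simp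
  show "is_ideal (adjoin I x)"
    unfolding is_ideal_def
  proof (intro conjI ballI allI)
    show "0 \<in> adjoin I x" using \<open>I \<subseteq> adjoin I x\<close> ideal_zero[OF I] by blast
    fix y assume "y \<in> adjoin I x"
    then obtain i r where y: "y = i + r * x" "i \<in> I" by (auto simp: adjoin_def)
    show "c * y \<in> adjoin I x" for c
      using ideal_mult_left[OF I y(2), of c] unfolding y(1) adjoin_def mem_Collect_eq
      by (intro exI[of _ "c * i"] exI[of _ "c * r"]) (simp add: algebra_simps)
    fix z assume "z \<in> adjoin I x"
    then obtain j s where z: "z = j + s * x" "j \<in> I" by (auto simp: adjoin_def)
    show "y + z \<in> adjoin I x"
      using ideal_add[OF I y(2) z(2)] unfolding y(1) z(1) adjoin_def mem_Collect_eq
      by (intro exI[of _ "i + j"] exI[of _ "r + s"]) (simp add: algebra_simps)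
  qed
qed

lemma principal_ideal: "is_ideal (range ((*) x))"
  unfolding is_ideal_def
proof (intro conjI ballI allI)
  show "0 \<in> range ((*) x)" by (rule range_eqI[of _ _ 0]) simp
  fix y assume "y \<in> range ((*) x)"
  then obtain a where y: "y = x * a" by auto
  show "r * y \<in> range ((*) x)" for r
    by (rule range_eqI[of _ _ "r * a"]) (simp add: y mult.left_commute)
  fix z assume "z \<in> range ((*) x)"
  then obtain b where z: "z = x * b" by auto
  show "y + z \<in> range ((*) x)"
    by (rule range_eqI[of _ _ "a + b"]) (simp add: y z distrib_left)
qed

text \<open>
  The generated ideal is an intersection of ideals; the explicit linear combinations of the
  generators form one of the ideals in that intersection.
\<close>

lemma ideal_finitely_generated:
  assumes noeth: "noetherian_domain (class_ring :: 'a::idom ring)" and I: "is_ideal (I :: 'a set)"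
  obtains G where "finite G" "G \<subseteq> I" "\<And>x. x \<in> I \<Longrightarrow> \<exists>c. x = (\<Sum>g\<in>G. c g * g)"
proof -
  interpret noetherian_domain "class_ring :: 'a ring" by (rule noeth)
  obtain G where G: "finite G" "I = genideal class_ring G"
    using finetely_gen[of I] I by (auto simp: ideal_class_ring_iff)
  let ?L = "{\<Sum>g\<in>G. c g * g | c. True}"
  have "is_ideal ?L"
    unfolding is_ideal_def
  proof (intro conjI ballI allI)
    show "0 \<in> ?L" by (auto intro!: exI[of _ "\<lambda>_. 0"])
    fix x assume "x \<in> ?L" then obtain c where x: "x = (\<Sum>g\<in>G. c g * g)" by auto
    show "r * x \<in> ?L" for r
      unfolding x by (auto simp: sum_distrib_left mult.assoc intro!: exI[of _ "\<lambda>g. r * c g"])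
    fix y assume "y \<in> ?L" then obtain d where y: "y = (\<Sum>g\<in>G. d g * g)" by auto
    show "x + y \<in> ?L"
      unfolding x y by (auto simp: sum.distrib[symmetric] distrib_right[symmetric]
          intro!: exI[of _ "\<lambda>g. c g + d g"])
  qed
  moreover have "G \<subseteq> ?L"
  proof
    fix g assume g: "g \<in> G"
    have "(\<Sum>h\<in>G. (if h = g then 1 else 0) * h) = (\<Sum>h\<in>G. if h = g then h else 0)"
      by (intro sum.cong) auto
    hence "g = (\<Sum>h\<in>G. (if h = g then 1 else 0) * h)" using g G(1) by simp
    thus "g \<in> ?L" by (intro CollectI exI[of _ "\<lambda>h. if h = g then 1 else 0"]) simp
  qed
  ultimately have "I \<subseteq> ?L" unfolding G(2) genideal_class_ring by blast
  moreover have "G \<subseteq> I" unfolding G(2) genideal_class_ring by blast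
  ultimately show ?thesis using that G(1) by blast
qed

text \<open>
  The noetherian hypothesis in the form that yields a largest counterexample to a statement about
  ideals. The union of a chain of ideals belongs to the chain, so Zorn's lemma applies.
\<close>

lemma noetherian_maximal_element:
  assumes noeth: "noetherian_domain (class_ring :: 'a::idom ring)"
    and S: "S \<noteq> {}" "\<And>I. I \<in> S \<Longrightarrow> is_ideal (I :: 'a set)"
  obtains M where "M \<in> S" "\<And>X. X \<in> S \<Longrightarrow> M \<subseteq> X \<Longrightarrow> X = M"
proof -
  interpret noetherian_domain "class_ring :: 'a ring" by (rule noeth)
  have "\<exists>M\<in>S. \<forall>X\<in>S. M \<subseteq> X \<longrightarrow> X = M"
  proof (rule subset_Zorn_nonempty[OF S(1)])
    fix C assume C: "C \<noteq> {}" "subset.chain S C"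
    have "subset.chain {I. ideal I class_ring} C"
      using C(2) S(2) unfolding subset.chain_def ideal_class_ring_iff by blast
    from ideal_chain_is_trivial[OF C(1) this] show "\<Union>C \<in> S"
      using C(2) unfolding subset.chain_def by blast
  qed
  thus ?thesis using that by blast
qed

section \<open>Maximal ideals and localisation\<close>

text \<open>
  The last clause says that the residue ring is a field; elementwise inverses modulo \<open>P\<close> are what the
  elimination needs.
\<close>

definition is_maximal :: "'a::comm_ring_1 set \<Rightarrow> bool" where
  "is_maximal P \<longleftrightarrow> is_ideal P \<and> 1 \<notin> P \<and> (\<forall>x. x \<notin> P \<longrightarrow> (\<exists>y. x * y - 1 \<in> P))"

lemma is_maximalD:
  assumes "is_maximal P"
  shows maximal_ideal: "is_ideal P"
    and maximal_one: "1 \<notin> P"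
    and maximal_inverse: "x \<notin> P \<Longrightarrow> \<exists>y. x * y - 1 \<in> P"
  using assms by (simp_all add: is_maximal_def)

lemma maximal_prime:
  assumes P: "is_maximal P" and xy: "x * y \<in> P" and x: "x \<notin> P"
  shows "y \<in> P"
proof -
  note I = maximal_ideal[OF P]
  obtain z where "x * z - 1 \<in> P" using maximal_inverse[OF P x] by blast
  hence "y * (x * z - 1) \<in> P" by (rule ideal_mult_left[OF I])
  moreover have "z * (x * y) \<in> P" using xy by (rule ideal_mult_left[OF I])
  moreover have "y = z * (x * y) - y * (x * z - 1)" by (simp add: algebra_simps)
  ultimately show ?thesis using ideal_diff[OF I] by metis
qed

lemma maximal_prod:
  assumes "is_maximal P" "\<And>i. i \<in> F \<Longrightarrow> f i \<notin> P"
  shows "prod f F \<notin> P"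
  using assms(2)
proof (induction F rule: infinite_finite_induct)
  case (insert x F)
  thus ?case using maximal_prime[OF assms(1), of "f x" "prod f F"] by auto
qed (use maximal_one[OF assms(1)] in auto)

lemma maximal_power: "is_maximal P \<Longrightarrow> x \<notin> P \<Longrightarrow> x ^ k \<notin> P"
  using maximal_prod[of P "{..<k}" "\<lambda>_. x"] by simp

lemma maximal_mult: "is_maximal P \<Longrightarrow> x \<notin> P \<Longrightarrow> y \<notin> P \<Longrightarrow> x * y \<notin> P"
  using maximal_prime by blast

lemma maximal_subset_eq:
  assumes P: "is_maximal P" and Q: "is_ideal Q" "1 \<notin> Q" and sub: "P \<subseteq> Q"
  shows "Q = P"
proof (rule ccontr)
  assume "Q \<noteq> P"
  then obtain x where x: "x \<in> Q" "x \<notin> P" using sub by blast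
  obtain y where "x * y - 1 \<in> P" using maximal_inverse[OF P x(2)] by blast
  hence "x * y - (x * y - 1) \<in> Q"
    using sub ideal_diff[OF Q(1) ideal_mult_right[OF Q(1) x(1)]] by blast
  thus False using Q(2) by simp
qed

text \<open>
  If \<open>x\<close> lies outside an ideal that is maximal among the proper ones, then \<open>M + (x)\<close> contains \<open>1\<close>, and
  the coefficient of \<open>x\<close> in such a representation is its inverse modulo \<open>M\<close>.
\<close>

lemma is_maximalI:
  assumes M: "is_ideal M" "1 \<notin> M"
    and max: "\<And>X. is_ideal X \<Longrightarrow> 1 \<notin> X \<Longrightarrow> M \<subseteq> X \<Longrightarrow> X = M"
  shows "is_maximal M"
  unfolding is_maximal_def
proof (intro conjI allI impI M)
  fix x assume x: "x \<notin> M"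
  note A = adjoin_ideal[OF M(1), of x]
  have "1 \<in> adjoin M x" using max[OF A(1) _ A(2)] A(3) x by blast
  then obtain i r where "1 = i + r * x" "i \<in> M" by (auto simp: adjoin_def)
  hence "x * r - 1 = - i" by (simp add: algebra_simps)
  hence "x * r - 1 \<in> M" using ideal_uminus[OF M(1) \<open>i \<in> M\<close>] by simp
  thus "\<exists>y. x * y - 1 \<in> M" by blast
qed

lemma ex_maximal_ideal:
  assumes noeth: "noetherian_domain (class_ring :: 'a::idom ring)"
    and I: "is_ideal (I :: 'a set)" "1 \<notin> I"
  obtains P where "is_maximal P" "I \<subseteq> P"
proof -
  obtain M where M: "M \<in> {J. is_ideal J \<and> 1 \<notin> J \<and> I \<subseteq> J}"
    and max: "\<And>X. X \<in> {J. is_ideal J \<and> 1 \<notin> J \<and> I \<subseteq> J} \<Longrightarrow> M \<subseteq> X \<Longrightarrow> X = M"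
    using noetherian_maximal_element[OF noeth, of "{J. is_ideal J \<and> 1 \<notin> J \<and> I \<subseteq> J}"] I by blast
  have "is_maximal M" using M max by (intro is_maximalI) auto
  thus ?thesis using that M by blast
qed

lemma dedekind_prime_maximal:
  assumes ded: "dedekind_domain TYPE('a::idom)"
    and P: "is_ideal (P :: 'a set)" "1 \<notin> P" "\<And>x y. x * y \<in> P \<Longrightarrow> x \<in> P \<or> y \<in> P" "P \<noteq> {0}"
  shows "is_maximal P"
proof -
  have "primeideal P class_ring"
  proof (rule primeidealI)
    show "ideal P class_ring" using P(1) by (simp add: ideal_class_ring_iff)
    show "cring (class_ring :: 'a ring)" by (rule class_cring.cring_axioms)
  qed (use P in auto)
  hence "maximalideal P class_ring" using ded P(4) by (simp add: dedekind_domain_def)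
  then interpret maximalideal P class_ring .
  show ?thesis
  proof (rule is_maximalI[OF P(1,2)])
    fix X assume X: "is_ideal X" "1 \<notin> X" "P \<subseteq> X"
    thus "X = P" using I_maximal[of X] by (auto simp: ideal_class_ring_iff)
  qed
qed

text \<open>
  The contraction to the ring of the extension of \<open>I\<close> to the local ring at \<open>P\<close>. It replaces the local
  ring: a statement about localised ideals becomes one about saturated ideals of the ring itself.
\<close>

definition sat :: "'a::comm_ring_1 set \<Rightarrow> 'a set \<Rightarrow> 'a set" where
  "sat P I = {y. \<exists>s. s \<notin> P \<and> s * y \<in> I}"

lemma sat_ideal:
  assumes P: "is_maximal P" and I: "is_ideal I"
  shows "is_ideal (sat P I)"
  unfolding is_ideal_def
proof (intro conjI ballI allI)
  show "0 \<in> sat P I" using maximal_one[OF P] ideal_zero[OF I] by (auto simp: sat_def)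
  fix x assume "x \<in> sat P I"
  then obtain s where s: "s \<notin> P" "s * x \<in> I" by (auto simp: sat_def)
  show "r * x \<in> sat P I" for r
    using s ideal_mult_left[OF I s(2), of r] by (auto simp: sat_def mult.left_commute)
  fix y assume "y \<in> sat P I"
  then obtain t where t: "t \<notin> P" "t * y \<in> I" by (auto simp: sat_def)
  have "t * (s * x) + s * (t * y) \<in> I" using s t ideal_add ideal_mult_left I by metis
  moreover have "t * (s * x) + s * (t * y) = (s * t) * (x + y)" by (simp add: algebra_simps)
  ultimately show "x + y \<in> sat P I"
    using maximal_mult[OF P s(1) t(1)] by (auto simp: sat_def)
qed

lemma sat_superset:
  assumes "is_maximal P"
  shows "I \<subseteq> sat P I"
proof
  fix x assume "x \<in> I"
  thus "x \<in> sat P I"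
    unfolding sat_def mem_Collect_eq using maximal_one[OF assms] by (intro exI[of _ 1]) simp
qed

lemma sat_cancel:
  assumes P: "is_maximal P" and "s \<notin> P" "s * x \<in> sat P I"
  shows "x \<in> sat P I"
proof -
  obtain t where "t \<notin> P" "t * (s * x) \<in> I" using assms(3) by (auto simp: sat_def)
  hence "t * s \<notin> P" "(t * s) * x \<in> I" using maximal_mult[OF P] assms(2) by (auto simp: mult.assoc)
  thus ?thesis by (auto simp: sat_def)
qed

lemma sat_subsetI:
  assumes P: "is_maximal P" and "I \<subseteq> sat P J"
  shows "sat P I \<subseteq> sat P J"
proof
  fix x assume "x \<in> sat P I"
  then obtain s where s: "s \<notin> P" "s * x \<in> I" by (auto simp: sat_def)
  thus "x \<in> sat P J" using sat_cancel[OF P s(1)] assms(2) by blast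
qed

lemma sat_memI:
  assumes "is_maximal P" "is_ideal J" "x \<in> sat P (range ((*) y))" "y \<in> sat P J"
  shows "x \<in> sat P J"
proof -
  have "range ((*) y) \<subseteq> sat P J"
    using ideal_mult_right[OF sat_ideal[OF assms(1,2)] assms(4)] by blast
  thus ?thesis using sat_subsetI[OF assms(1)] assms(3) by blast
qed

text \<open>
  For \<open>x\<close> in \<open>I\<close>, the ideal of all \<open>s\<close> with \<open>s * x\<close> in \<open>J\<close> lies in no maximal ideal, hence contains \<open>1\<close>.
\<close>

lemma local_global:
  assumes noeth: "noetherian_domain (class_ring :: 'a::idom ring)"
    and J: "is_ideal (J :: 'a set)"
    and loc: "\<And>P. is_maximal P \<Longrightarrow> I \<subseteq> sat P J"
  shows "I \<subseteq> J"
proof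
  fix x assume x: "x \<in> I"
  let ?C = "{s. s * x \<in> J}"
  have C: "is_ideal ?C"
    unfolding is_ideal_def
  proof (intro conjI ballI allI)
    show "0 \<in> ?C" using ideal_zero[OF J] by simp
    show "r * s \<in> ?C" if "s \<in> ?C" for r s
      using ideal_mult_left[OF J, of "s * x" r] that by (simp add: mult.assoc)
    show "s + t \<in> ?C" if "s \<in> ?C" "t \<in> ?C" for s t
      using ideal_add[OF J, of "s * x" "t * x"] that by (simp add: distrib_right)
  qed
  have "1 \<in> ?C"
  proof (rule ccontr)
    assume "1 \<notin> ?C"
    then obtain P where P: "is_maximal P" "?C \<subseteq> P" using ex_maximal_ideal[OF noeth C] by blast
    obtain s where "s \<notin> P" "s * x \<in> J" using loc[OF P(1)] x by (auto simp: sat_def)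
    thus False using P(2) by auto
  qed
  thus "x \<in> J" by simp
qed

section \<open>Divisibility in the local rings of a Dedekind domain\<close>

text \<open>
  A product of ideals \<open>Ps\<close> inside an ideal is expressed through products of elements chosen one from
  each factor; these products generate the product ideal.
\<close>

lemma maximal_contains_factor:
  assumes P: "is_maximal P"
    and "\<And>xs. list_all2 (\<in>) xs Ps \<Longrightarrow> prod_list xs \<in> P"
  shows "\<exists>Q\<in>set Ps. Q \<subseteq> P"
  using assms(2)
proof (induction Ps)
  case Nil
  from Nil[of "[]"] show ?case using maximal_one[OF P] by simp
next
  case (Cons Q Ps)
  show ?case
  proof (cases "Q \<subseteq> P")
    case False
    then obtain x where x: "x \<in> Q" "x \<notin> P" by blast
    have "prod_list xs \<in> P" if "list_all2 (\<in>) xs Ps" for xs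
      using Cons.prems[of "x # xs"] that x(1) maximal_prime[OF P _ x(2)] by simp
    thus ?thesis using Cons.IH by auto
  qed auto
qed

text \<open>
  Noetherian induction: an ideal \<open>M\<close> that is maximal among the counterexamples is not a nonzero prime
  ideal, so \<open>x * y\<close> lies in \<open>M\<close> for some \<open>x\<close> and \<open>y\<close> outside \<open>M\<close>. The larger ideals \<open>M + (x)\<close> and
  \<open>M + (y)\<close> contain products of maximal ideals, and the product of the two ideals is contained in \<open>M\<close>.
\<close>

lemma ideal_contains_product_of_maximals:
  assumes ded: "dedekind_domain TYPE('a::idom)"
    and I: "is_ideal (I :: 'a set)" "I \<noteq> {0}"
  shows "\<exists>Ps. (\<forall>P\<in>set Ps. is_maximal P \<and> P \<noteq> {0}) \<and>
              (\<forall>xs. list_all2 (\<in>) xs Ps \<longrightarrow> prod_list xs \<in> I)"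
proof (rule ccontr)
  let ?good = "\<lambda>I. \<exists>Ps. (\<forall>P\<in>set Ps. is_maximal P \<and> P \<noteq> {0}) \<and>
              (\<forall>xs. list_all2 (\<in>) xs Ps \<longrightarrow> prod_list xs \<in> (I :: 'a set))"
  let ?S = "{I :: 'a set. is_ideal I \<and> I \<noteq> {0} \<and> \<not> ?good I}"
  have noeth: "noetherian_domain (class_ring :: 'a ring)"
    using ded by (simp add: dedekind_domain_def)
  assume "\<not> ?good I"
  hence "?S \<noteq> {}" using I by blast
  then obtain M where M: "M \<in> ?S" and max: "\<And>X. X \<in> ?S \<Longrightarrow> M \<subseteq> X \<Longrightarrow> X = M"
    using noetherian_maximal_element[OF noeth, of ?S] by blast
  have ideal: "is_ideal M" and nz: "M \<noteq> {0}" and bad: "\<not> ?good M" using M by auto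
  have larger: "?good (adjoin M x)" if "x \<notin> M" for x
  proof (rule ccontr)
    note A = adjoin_ideal[OF ideal, of x]
    assume "\<not> ?good (adjoin M x)"
    moreover have "adjoin M x \<noteq> {0}" using A(2) nz ideal_zero[OF ideal] by blast
    ultimately have "adjoin M x = M" using max A by blast
    thus False using A(3) that by blast
  qed
  have "1 \<notin> M"
  proof
    assume one: "1 \<in> M"
    hence "?good M" by (intro exI[of _ "[]"]) simp
    thus False using bad by blast
  qed
  moreover have "x \<in> M \<or> y \<in> M" if xy: "x * y \<in> M" for x y
  proof (rule ccontr)
    assume "\<not> (x \<in> M \<or> y \<in> M)"
    hence x: "x \<notin> M" and y: "y \<notin> M" by auto
    obtain Ps where Ps: "\<forall>P\<in>set Ps. is_maximal P \<and> P \<noteq> {0}"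
        "\<forall>xs. list_all2 (\<in>) xs Ps \<longrightarrow> prod_list xs \<in> adjoin M x"
      using larger[OF x] by blast
    obtain Qs where Qs: "\<forall>P\<in>set Qs. is_maximal P \<and> P \<noteq> {0}"
        "\<forall>xs. list_all2 (\<in>) xs Qs \<longrightarrow> prod_list xs \<in> adjoin M y"
      using larger[OF y] by blast
    have "prod_list zs \<in> M" if "list_all2 (\<in>) zs (Ps @ Qs)" for zs
    proof -
      obtain xs ys where zs: "zs = xs @ ys" "list_all2 (\<in>) xs Ps" "list_all2 (\<in>) ys Qs"
        using \<open>list_all2 (\<in>) zs (Ps @ Qs)\<close> by (auto simp: list_all2_append2)
      obtain i r where 1: "prod_list xs = i + r * x" "i \<in> M"
        using Ps(2) zs(2) by (auto simp: adjoin_def)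
      obtain j s where 2: "prod_list ys = j + s * y" "j \<in> M"
        using Qs(2) zs(3) by (auto simp: adjoin_def)
      have "prod_list zs = (j + s * y) * i + ((r * x) * j + (r * s) * (x * y))"
        by (simp add: zs(1) 1 2 algebra_simps)
      also have "\<dots> \<in> M"
        by (intro ideal_add[OF ideal] ideal_mult_left[OF ideal] 1 2 xy)
      finally show ?thesis .
    qed
    hence "?good M" using Ps(1) Qs(1) by (intro exI[of _ "Ps @ Qs"]) auto
    thus False using bad by blast
  qed
  ultimately have "is_maximal M"
    using dedekind_prime_maximal[OF ded ideal _ _ nz] by blast
  hence "?good M" using nz by (intro exI[of _ "[M]"]) (auto simp: list_all2_Cons2)
  thus False using bad by blast
qed

text \<open>
  Every maximal ideal that contains \<open>d\<close> is one of the factors of a product of maximal ideals contained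
  in \<open>(d)\<close>.
\<close>

lemma finite_maximal_ideals_containing:
  assumes ded: "dedekind_domain TYPE('a::idom)" and d: "(d::'a) \<noteq> 0"
  shows "finite {P. is_maximal P \<and> d \<in> P}"
proof -
  have "range ((*) d) \<noteq> {0}" using d by (metis mult.right_neutral rangeI singletonD)
  then obtain Ps where Ps: "\<forall>P\<in>set Ps. is_maximal P \<and> P \<noteq> {0}"
      "\<forall>xs. list_all2 (\<in>) xs Ps \<longrightarrow> prod_list xs \<in> range ((*) d)"
    using ideal_contains_product_of_maximals[OF ded principal_ideal[of d]] by blast
  have "P \<in> set Ps" if P: "is_maximal P" "d \<in> P" for P
  proof -
    have "range ((*) d) \<subseteq> P" using ideal_mult_right[OF maximal_ideal[OF P(1)] P(2)] by blast
    then obtain Q where "Q \<in> set Ps" "Q \<subseteq> P"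
      using maximal_contains_factor[OF P(1), of Ps] Ps(2) by blast
    thus ?thesis
      using maximal_subset_eq[of Q P] Ps(1) maximal_ideal[OF P(1)] maximal_one[OF P(1)] by blast
  qed
  hence "{P. is_maximal P \<and> d \<in> P} \<subseteq> set Ps" by blast
  thus ?thesis using finite_subset by blast
qed

lemma to_fract_hom: "comm_ring_hom (to_fract :: 'a::idom \<Rightarrow> 'a fract)"
  by unfold_locales simp_all

text \<open>
  Multiplication by \<open>b / a\<close> maps the ideal generated by \<open>G\<close> into itself. So \<open>b / a\<close> is an eigenvalue of
  a matrix over the ring, a root of its monic characteristic polynomial, and therefore lies in the
  integrally closed ring.
\<close>

lemma stable_quotient_dvd:
  assumes int_closed: "integrally_closed_domain TYPE('a::idom)"
    and G: "finite G" "g0 \<in> G" "(g0 :: 'a) \<noteq> 0"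
    and a: "a \<noteq> 0"
    and stable: "\<And>g. g \<in> G \<Longrightarrow> b * g = a * (\<Sum>h\<in>G. c g h * h)"
  shows "a dvd b"
proof -
  interpret F: comm_ring_hom "to_fract :: 'a \<Rightarrow> 'a fract" by (rule to_fract_hom)
  obtain gs where gs: "set gs = G" "distinct gs" using finite_distinct_list[OF G(1)] by blast
  define n where "n = length gs"
  define C where "C = mat n n (\<lambda>(i,j). c (gs ! i) (gs ! j))"
  define v where "v = vec n (\<lambda>i. to_fract (gs ! i))"
  define y where "y = to_fract b / to_fract a"
  have C: "C \<in> carrier_mat n n" by (simp add: C_def)
  let ?C = "map_mat to_fract C"
  have a': "to_fract a \<noteq> 0" using a by simp
  have "?C *\<^sub>v v = y \<cdot>\<^sub>v v"
  proof (rule eq_vecI)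
    show "dim_vec (?C *\<^sub>v v) = dim_vec (y \<cdot>\<^sub>v v)" by (simp add: C_def v_def)
    fix i assume "i < dim_vec (y \<cdot>\<^sub>v v)"
    hence i: "i < n" by (simp add: v_def)
    have "(\<Sum>h\<in>G. c (gs ! i) h * h) = (\<Sum>j<n. c (gs ! i) (gs ! j) * gs ! j)"
      unfolding gs(1)[symmetric] sum.distinct_set_conv_list[OF gs(2)] sum_list_sum_nth n_def
      by (simp add: lessThan_atLeast0)
    moreover have "gs ! i \<in> G" using i gs(1) n_def by auto
    ultimately have "b * gs ! i = a * (\<Sum>j<n. c (gs ! i) (gs ! j) * gs ! j)"
      using stable by metis
    hence "to_fract b * to_fract (gs ! i) =
        to_fract a * (\<Sum>j<n. to_fract (c (gs ! i) (gs ! j)) * to_fract (gs ! j))"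
      by (metis (no_types, lifting) F.hom_mult F.hom_sum sum.cong)
    hence "(\<Sum>j<n. to_fract (c (gs ! i) (gs ! j)) * to_fract (gs ! j)) = y * to_fract (gs ! i)"
      using a' by (simp add: y_def field_simps)
    thus "(?C *\<^sub>v v) $ i = (y \<cdot>\<^sub>v v) $ i"
      using i by (simp add: C_def v_def scalar_prod_def lessThan_atLeast0)
  qed
  moreover have "v \<noteq> 0\<^sub>v n"
  proof
    assume v0: "v = 0\<^sub>v n"
    obtain i where "i < n" "gs ! i = g0" using G(2) gs(1) n_def by (metis in_set_conv_nth)
    hence "to_fract g0 = 0" using v0 by (metis index_vec index_zero_vec(1) v_def)
    thus False using G(3) by simp
  qed
  ultimately have "eigenvalue ?C y"
    unfolding eigenvalue_def eigenvector_def by (intro exI[of _ v]) (simp add: C_def v_def)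
  moreover have C': "?C \<in> carrier_mat n n" using C by simp
  ultimately have "poly (char_poly ?C) y = 0" using eigenvalue_root_char_poly by blast
  hence "poly (map_poly to_fract (char_poly C)) y = 0" by (simp add: F.char_poly_hom[OF C])
  moreover have "lead_coeff (char_poly C) = 1" using degree_monic_char_poly[OF C] by simp
  ultimately have "y \<in> range to_fract" using int_closed unfolding integrally_closed_domain_def by blast
  then obtain z where "y = to_fract z" by blast
  hence "to_fract b = to_fract (a * z)" using a' by (simp add: y_def field_simps)
  hence "b = a * z" by (simp only: to_fract_eq_iff)
  thus ?thesis by simp
qed

text \<open>
  The maximal ideal of the local ring at \<open>P\<close> is principal. Choose \<open>a \<noteq> 0\<close> in \<open>P\<close> and a shortest product of
  nonzero maximal ideals inside \<open>(a)\<close>. One of its factors is \<open>P\<close>; the other factors provide an element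
  \<open>b\<close> outside \<open>(a)\<close> such that \<open>b P\<close> is contained in \<open>(a)\<close>. If \<open>(b / a) P\<close> were contained in \<open>P\<close>, then
  \<open>b / a\<close> would be integral. So \<open>(b / a) p = s\<close> lies outside \<open>P\<close> for some \<open>p\<close> in \<open>P\<close>, and this \<open>p\<close>
  divides \<open>s x\<close> for every \<open>x\<close> in \<open>P\<close>.
\<close>

lemma local_generator:
  assumes ded: "dedekind_domain TYPE('a::idom)"
    and P: "is_maximal (P :: 'a set)" "P \<noteq> {0}"
  obtains p s where "p \<in> P" "s \<notin> P" "\<And>x. x \<in> P \<Longrightarrow> \<exists>z. s * x = p * z"
proof -
  have noeth: "noetherian_domain (class_ring :: 'a ring)"
    and closed: "integrally_closed_domain TYPE('a)"
    using ded by (simp_all add: dedekind_domain_def)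
  note I = maximal_ideal[OF P(1)]
  obtain a where a: "a \<in> P" "a \<noteq> 0" using P(2) ideal_zero[OF I] by blast
  define good where "good = (\<lambda>Ps. (\<forall>Q\<in>set Ps. is_maximal Q \<and> Q \<noteq> {0}) \<and>
              (\<forall>xs. list_all2 (\<in>) xs Ps \<longrightarrow> prod_list xs \<in> range ((*) a)))"
  have "range ((*) a) \<noteq> {0}" using a(2) by (metis mult.right_neutral rangeI singletonD)
  hence "\<exists>Ps. good Ps"
    unfolding good_def by (rule ideal_contains_product_of_maximals[OF ded principal_ideal])
  then obtain Ps where Ps: "good Ps" and min: "\<And>Qs. good Qs \<Longrightarrow> length Ps \<le> length Qs"
    using ex_has_least_nat[of good _ length] by blast
  have "range ((*) a) \<subseteq> P" using ideal_mult_right[OF I a(1)] by blast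
  then obtain Q where Q: "Q \<in> set Ps" "Q \<subseteq> P"
    using maximal_contains_factor[OF P(1), of Ps] Ps unfolding good_def by blast
  hence "Q = P" using maximal_subset_eq[of Q P] Ps I maximal_one[OF P(1)] unfolding good_def by blast
  then obtain us vs where split: "Ps = us @ P # vs" using Q(1) by (meson split_list)
  have "\<not> good (us @ vs)" using min[of "us @ vs"] split by auto
  then obtain xs where xs: "list_all2 (\<in>) xs (us @ vs)" "prod_list xs \<notin> range ((*) a)"
    using Ps unfolding good_def split by auto
  define b where "b = prod_list xs"
  have b: "\<exists>c. b * x = a * c" if x: "x \<in> P" for x
  proof -
    obtain ys zs where "xs = ys @ zs" "list_all2 (\<in>) ys us" "list_all2 (\<in>) zs vs"
      using xs(1) by (auto simp: list_all2_append2)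
    moreover from this have "list_all2 (\<in>) (ys @ x # zs) Ps"
      using x unfolding split by (intro list_all2_appendI) auto
    hence "prod_list (ys @ x # zs) \<in> range ((*) a)" using Ps unfolding good_def by blast
    ultimately show ?thesis by (auto simp: b_def mult_ac)
  qed
  \<comment> \<open>Otherwise \<open>b / a\<close> maps the finitely generated ideal \<open>P\<close> into itself.\<close>
  have "\<exists>p\<in>P. \<exists>s. s \<notin> P \<and> b * p = a * s"
  proof (rule ccontr)
    assume contra: "\<not> ?thesis"
    obtain G where G: "finite G" "G \<subseteq> P" "\<And>x. x \<in> P \<Longrightarrow> \<exists>c. x = (\<Sum>g\<in>G. c g * g)"
      using ideal_finitely_generated[OF noeth I] by metis
    have "\<exists>c. b * g = a * (\<Sum>h\<in>G. c h * h)" if g: "g \<in> G" for g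
    proof -
      obtain x where x: "b * g = a * x" using b g G(2) by blast
      hence "x \<in> P" using contra g G(2) by blast
      thus ?thesis using G(3) x by metis
    qed
    then obtain c where c: "\<And>g. g \<in> G \<Longrightarrow> b * g = a * (\<Sum>h\<in>G. c g h * h)" by metis
    have "\<exists>g\<in>G. g \<noteq> 0"
    proof (rule ccontr)
      assume "\<not> ?thesis"
      hence "x = 0" if "x \<in> P" for x using G(3)[OF that] by (auto intro: sum.neutral)
      thus False using a by blast
    qed
    then obtain g where "g \<in> G" "g \<noteq> 0" by blast
    hence "a dvd b" using stable_quotient_dvd[OF closed G(1) _ _ a(2)] c by metis
    thus False using xs(2) unfolding b_def by (auto elim: dvdE)
  qed
  then obtain p s where ps: "p \<in> P" "s \<notin> P" "b * p = a * s" by blast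
  have "\<exists>z. s * x = p * z" if "x \<in> P" for x
  proof -
    obtain z where z: "b * x = a * z" using b \<open>x \<in> P\<close> by blast
    have "a * (s * x) = (b * p) * x" by (simp only: ps(3) mult.assoc)
    also have "\<dots> = p * (b * x)" by (simp only: mult_ac)
    also have "\<dots> = a * (p * z)" by (simp only: z mult_ac)
    finally show ?thesis using a(2) by auto
  qed
  thus ?thesis using that ps by blast
qed

text \<open>
  Divisibility in the local ring at \<open>P\<close>.
\<close>

definition ldvd :: "'a::comm_ring_1 set \<Rightarrow> 'a \<Rightarrow> 'a \<Rightarrow> bool" where
  "ldvd P x y \<longleftrightarrow> y \<in> sat P (range ((*) x))"

lemma ldvd_iff: "ldvd P x y \<longleftrightarrow> (\<exists>s c. s \<notin> P \<and> s * y = x * c)"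
  by (auto simp: ldvd_def sat_def)

text \<open>
  The local rings are valuation rings. Two incomparable elements \<open>x\<close> and \<open>y\<close> both lie in \<open>P\<close>, so the
  local generator \<open>p\<close> can be cancelled from them. The quotients \<open>x'\<close> and \<open>y'\<close> are again incomparable,
  and \<open>x'\<close> generates locally a larger ideal than \<open>x\<close>; noetherian induction excludes this.
\<close>

lemma ldvd_total:
  assumes ded: "dedekind_domain TYPE('a::idom)"
    and P: "is_maximal (P :: 'a set)" "P \<noteq> {0}"
  shows "ldvd P x y \<or> ldvd P y x"
proof (rule ccontr)
  assume xy: "\<not> ?thesis"
  define bad where "bad = (\<lambda>x y. \<not> ldvd P x y \<and> \<not> ldvd P y x)"
  have noeth: "noetherian_domain (class_ring :: 'a ring)"
    using ded by (simp_all add: dedekind_domain_def)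
  note I = maximal_ideal[OF P(1)]
  let ?S = "{sat P (range ((*) x)) | x. \<exists>y. bad x y}"
  have "?S \<noteq> {}" using xy by (auto simp: bad_def)
  then obtain M where M: "M \<in> ?S" and max: "\<And>X. X \<in> ?S \<Longrightarrow> M \<subseteq> X \<Longrightarrow> X = M"
    using noetherian_maximal_element[OF noeth, of ?S] sat_ideal[OF P(1) principal_ideal] by blast
  then obtain x y where M_eq: "M = sat P (range ((*) x))" and bad: "bad x y" by blast
  obtain p s where p: "p \<in> P" and s: "s \<notin> P" and gen: "\<And>x. x \<in> P \<Longrightarrow> \<exists>z. s * x = p * z"
    using local_generator[OF ded P] by metis
  have unit: "ldvd P u v" if "u \<notin> P" for u v
    unfolding ldvd_iff using that by (intro exI[of _ u] exI[of _ v]) simp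
  have zero: "ldvd P u 0" for u
    unfolding ldvd_iff using s by (intro exI[of _ s] exI[of _ 0]) simp
  have "x \<in> P" "y \<in> P" using bad unit unfolding bad_def by blast+
  then obtain x' y' where x': "s * x = p * x'" and y': "s * y = p * y'" using gen by blast
  have x0: "x \<noteq> 0" using bad zero unfolding bad_def by blast
  have s0: "s \<noteq> 0" using s ideal_zero[OF I] by blast
  have p0: "p \<noteq> 0" using x' x0 s0 by auto
  have lift: "ldvd P u v" if loc: "ldvd P u' v'" and "s * u = p * u'" "s * v = p * v'" for u v u' v'
  proof -
    obtain t c where t: "t \<notin> P" "t * v' = u' * c" using loc by (auto simp: ldvd_iff)
    have "(t * s) * v = t * (s * v)" by (simp only: mult.assoc)
    also have "\<dots> = t * (p * v')" by (simp only: that(3))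
    also have "\<dots> = p * (t * v')" by (simp only: mult.left_commute)
    also have "\<dots> = p * (u' * c)" by (simp only: t(2))
    also have "\<dots> = (p * u') * c" by (simp only: mult.assoc)
    also have "\<dots> = (s * u) * c" by (simp only: that(2))
    also have "\<dots> = u * (s * c)" by (simp only: mult_ac)
    finally show ?thesis unfolding ldvd_iff using maximal_mult[OF P(1) t(1) s] by blast
  qed
  have "bad x' y'" using bad lift x' y' unfolding bad_def by blast
  moreover have sub: "M \<subseteq> sat P (range ((*) x'))"
    unfolding M_eq
  proof (rule sat_subsetI[OF P(1)], rule subsetI)
    fix z assume "z \<in> range ((*) x)"
    then obtain c where "z = x * c" by blast
    hence "s * z = (s * x) * c" by (simp only: mult.assoc)
    also have "\<dots> = (p * x') * c" by (simp only: x')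
    also have "\<dots> = x' * (p * c)" by (simp only: mult_ac)
    finally have "s * z = x' * (p * c)" .
    thus "z \<in> sat P (range ((*) x'))" using s by (auto simp: sat_def)
  qed
  ultimately have "sat P (range ((*) x')) = M" using max by blast
  moreover have "x' \<in> sat P (range ((*) x'))"
    using sat_superset[OF P(1)] by (metis mult.right_neutral rangeI subsetD)
  ultimately obtain t c where t: "t \<notin> P" "t * x' = x * c" unfolding M_eq by (auto simp: sat_def)
  have "x * (t * s) = t * (s * x)" by (simp add: mult_ac)
  also have "\<dots> = t * (p * x')" by (simp only: x')
  also have "\<dots> = p * (t * x')" by (simp only: mult.left_commute)
  also have "\<dots> = p * (x * c)" by (simp only: t(2))
  also have "\<dots> = x * (p * c)" by (simp only: mult.left_commute)
  finally have "t * s = p * c" using x0 by simp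
  moreover have "p * c \<in> P" by (rule ideal_mult_right[OF I p])
  ultimately show False using maximal_mult[OF P(1) t(1) s] by simp
qed

section \<open>Minors and determinantal divisors\<close>

text \<open>
  Rows and columns are selected by arbitrary functions, repetitions and reorderings included: these
  are the selections that occur when a minor of a product is expanded.
\<close>

definition minor :: "'a::comm_ring_1 mat \<Rightarrow> nat \<Rightarrow> (nat \<Rightarrow> nat) \<Rightarrow> (nat \<Rightarrow> nat) \<Rightarrow> 'a" where
  "minor A k f g = det (mat k k (\<lambda>(i,j). A $$ (f i, g j)))"

lemma minor_sum:
  "minor A k f g = (\<Sum>p | p permutes {0..<k}. signof p * (\<Prod>i=0..<k. A $$ (f i, g (p i))))"
proof -
  have "(\<Prod>i=0..<k. mat k k (\<lambda>(i,j). A $$ (f i, g j)) $$ (i, p i)) =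
      (\<Prod>i=0..<k. A $$ (f i, g (p i)))" if "p permutes {0..<k}" for p
    using permutes_in_image[OF that] by (intro prod.cong) auto
  thus ?thesis unfolding minor_def by (subst det_def'[of _ k]) auto
qed

lemma minor_transpose:
  assumes "A \<in> carrier_mat m n" "f \<in> {0..<k} \<rightarrow> {0..<n}" "g \<in> {0..<k} \<rightarrow> {0..<m}"
  shows "minor (transpose_mat A) k f g = minor A k g f"
proof -
  have "mat k k (\<lambda>(i,j). transpose_mat A $$ (f i, g j)) =
      transpose_mat (mat k k (\<lambda>(i,j). A $$ (g i, f j)))"
    using assms by (intro eq_matI) (auto simp: Pi_iff)
  thus ?thesis unfolding minor_def by (simp add: det_transpose[of _ k])
qed

lemma minor_cong:
  assumes "\<And>i j. i < k \<Longrightarrow> j < k \<Longrightarrow> A $$ (f i, g j) = B $$ (f' i, g' j)"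
  shows "minor A k f g = minor B k f' g'"
  unfolding minor_def by (intro arg_cong[of _ _ det] eq_matI) (auto simp: assms)

text \<open>
  A repeated row makes the minor vanish; otherwise sorting the rows only costs a sign.
\<close>

lemma minor_rows_sorted:
  assumes f: "f \<in> {0..<k} \<rightarrow> {0..<m}"
  shows "\<exists>c f'. minor A k f g = c * minor A k f' g \<and> f' \<in> {0..<k} \<rightarrow> {0..<m} \<and>
           strict_mono_on {0..<k} f' \<or> minor A k f g = 0"
proof (cases "inj_on f {0..<k}")
  case False
  then obtain i j where ij: "i < k" "j < k" "i \<noteq> j" "f i = f j" by (auto simp: inj_on_def)
  have "minor A k f g = 0"
    unfolding minor_def using ij
    by (intro det_identical_rows[of _ k i j] eq_vecI) (auto simp: row_def)
  thus ?thesis by blast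
next
  case True
  define I where "I = f ` {0..<k}"
  have card: "card I = k" unfolding I_def using card_image[OF True] by simp
  have mono: "strict_mono_on {0..<k} (pick I)"
    by (intro strict_mono_onI) (use card pick_mono_le in auto)
  have "inj_on (pick I) {0..<k}" using mono strict_mono_on_imp_inj_on by blast
  moreover have "pick I ` {0..<k} \<subseteq> I" using pick_in_set_le card by auto
  moreover have "finite I" by (simp add: I_def)
  ultimately have bij: "bij_betw (pick I) {0..<k} I"
    using card by (metis bij_betw_def card_atLeastLessThan card_image card_subset_eq diff_zero)
  have bijf: "bij_betw f {0..<k} I" using True by (simp add: I_def bij_betw_def)
  define p where "p = (\<lambda>i. if i < k then the_inv_into {0..<k} (pick I) (f i) else i)"
  have "bij_betw (the_inv_into {0..<k} (pick I) \<circ> f) {0..<k} {0..<k}"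
    using bijf bij bij_betw_the_inv_into bij_betw_trans by blast
  moreover have "bij_betw (the_inv_into {0..<k} (pick I) \<circ> f) {0..<k} {0..<k} =
      bij_betw p {0..<k} {0..<k}"
    by (intro bij_betw_cong) (simp add: p_def)
  ultimately have perm: "p permutes {0..<k}"
    by (intro bij_imp_permutes) (auto simp: p_def)
  have pick_p: "pick I (p i) = f i" if "i < k" for i
  proof -
    have "f i \<in> pick I ` {0..<k}" using bij that unfolding bij_betw_def I_def by auto
    thus ?thesis using that f_the_inv_into_f[of "pick I" "{0..<k}" "f i"] bij
      by (simp add: p_def bij_betw_def)
  qed
  have p_less: "p i < k" if "i < k" for i using permutes_in_image[OF perm, of i] that by simp
  let ?M = "mat k k (\<lambda>(i,j). A $$ (pick I i, g j))"
  have "mat k k (\<lambda>(i,j). A $$ (f i, g j)) = mat k k (\<lambda>(i,j). ?M $$ (p i, j))"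
    by (intro eq_matI) (auto simp: pick_p p_less)
  hence "minor A k f g = signof p * minor A k (pick I) g"
    unfolding minor_def using det_permute_rows[OF _ perm, of ?M] by simp
  moreover have "pick I \<in> {0..<k} \<rightarrow> {0..<m}"
  proof (rule funcsetI)
    fix i assume "i \<in> {0..<k}"
    hence "pick I i \<in> I" using pick_in_set_le[of i I] card by simp
    moreover have "I \<subseteq> {0..<m}" using f by (auto simp: I_def)
    ultimately show "pick I i \<in> {0..<m}" by (rule rev_subsetD)
  qed
  ultimately show ?thesis using mono by blast
qed

lemma is_ideal_Inter:
  assumes "\<And>I. I \<in> S \<Longrightarrow> is_ideal I"
  shows "is_ideal (\<Inter>S)"
  unfolding is_ideal_def
proof (intro conjI ballI allI InterI)
  fix I assume I: "I \<in> S"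
  note ideal = assms[OF I]
  show "0 \<in> I" by (rule ideal_zero[OF ideal])
  fix x assume x: "x \<in> \<Inter>S"
  show "r * x \<in> I" for r using ideal_mult_left[OF ideal] x I by blast
  show "x + y \<in> I" if "y \<in> \<Inter>S" for y using ideal_add[OF ideal] x that I by blast
qed

lemma det_divisor_ideal: "is_ideal (det_divisor k A)"
  unfolding det_divisor_def genideal_class_ring by (rule is_ideal_Inter) auto

lemma det_submatrix:
  assumes A: "A \<in> carrier_mat m n"
    and IJ: "I \<subseteq> {..<m}" "J \<subseteq> {..<n}" "card I = k" "card J = k"
  shows "det (submatrix A I J) = minor A k (pick I) (pick J)"
    "pick I \<in> {0..<k} \<rightarrow> {0..<m}" "pick J \<in> {0..<k} \<rightarrow> {0..<n}"
    "strict_mono_on {0..<k} (pick I)" "strict_mono_on {0..<k} (pick J)"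
proof -
  have "{i. i < dim_row A \<and> i \<in> I} = I" "{j. j < dim_col A \<and> j \<in> J} = J" using A IJ by auto
  thus "det (submatrix A I J) = minor A k (pick I) (pick J)"
    using IJ by (simp add: submatrix_def minor_def)
  have "pick I i \<in> {0..<m}" "pick J i \<in> {0..<n}" if "i < k" for i
    using that pick_in_set_le[of i I] pick_in_set_le[of i J] IJ by auto
  thus "pick I \<in> {0..<k} \<rightarrow> {0..<m}" "pick J \<in> {0..<k} \<rightarrow> {0..<n}"
    by (simp_all add: Pi_iff)
  show "strict_mono_on {0..<k} (pick I)"
    by (rule strict_mono_onI) (use IJ(3) pick_mono_le in auto)
  show "strict_mono_on {0..<k} (pick J)"
    by (rule strict_mono_onI) (use IJ(4) pick_mono_le in auto)
qed

lemma det_divisor_subsetI: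
  assumes A: "A \<in> carrier_mat m n" and X: "is_ideal X"
    and "\<And>f g. f \<in> {0..<k} \<rightarrow> {0..<m} \<Longrightarrow> g \<in> {0..<k} \<rightarrow> {0..<n} \<Longrightarrow>
      strict_mono_on {0..<k} f \<Longrightarrow> strict_mono_on {0..<k} g \<Longrightarrow> minor A k f g \<in> X"
  shows "det_divisor k A \<subseteq> X"
proof -
  have "det (submatrix A I J) \<in> X"
    if "I \<subseteq> {..<m}" "J \<subseteq> {..<n}" "card I = k" "card J = k" for I J
    using det_submatrix[OF A that] assms(3) by simp
  hence "{det (submatrix A I J) | I J. I \<subseteq> {..<dim_row A} \<and> J \<subseteq> {..<dim_col A} \<and>
      card I = k \<and> card J = k} \<subseteq> X" using A by auto
  thus ?thesis unfolding det_divisor_def genideal_class_ring using X by blast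
qed

lemma strict_mono_on_image_pick:
  assumes f: "strict_mono_on {0..<k} f"
  shows "card (f ` {0..<k}) = k" "\<And>i. i < k \<Longrightarrow> pick (f ` {0..<k}) i = f i"
proof -
  have inj: "inj_on f {0..<k}" using f strict_mono_on_imp_inj_on by blast
  show card: "card (f ` {0..<k}) = k" using card_image[OF inj] by simp
  fix i assume i: "i < k"
  have "{a \<in> f ` {0..<k}. a < f i} = f ` {0..<i}"
    using i strict_mono_on_less[OF f] by auto
  moreover have "inj_on f {0..<i}" using inj by (rule inj_on_subset) (use i in auto)
  ultimately have "card {a \<in> f ` {0..<k}. a < f i} = i" using card_image by fastforce
  thus "pick (f ` {0..<k}) i = f i" using pick_card_in_set[of "f i" "f ` {0..<k}"] i by auto
qed

text \<open>
  With \<open>det_divisor_subsetI\<close>, this allows sorted selections to be assumed when an ideal containing all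
  minors is sought, and arbitrary ones to be used when a minor is known to lie in the determinantal
  divisor.
\<close>

lemma minor_in_det_divisor:
  assumes A: "A \<in> carrier_mat m n"
    and f: "f \<in> {0..<k} \<rightarrow> {0..<m}" and g: "g \<in> {0..<k} \<rightarrow> {0..<n}"
  shows "minor A k f g \<in> det_divisor k A"
proof -
  note X = det_divisor_ideal[of k A]
  have sorted: "minor A k f g \<in> det_divisor k A"
    if "f \<in> {0..<k} \<rightarrow> {0..<m}" "g \<in> {0..<k} \<rightarrow> {0..<n}"
      "strict_mono_on {0..<k} f" "strict_mono_on {0..<k} g" for f g
  proof -
    let ?I = "f ` {0..<k}" and ?J = "g ` {0..<k}"
    have IJ: "?I \<subseteq> {..<m}" "?J \<subseteq> {..<n}" "card ?I = k" "card ?J = k"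
      using that strict_mono_on_image_pick(1) by auto
    have "minor A k f g = minor A k (pick ?I) (pick ?J)"
      using strict_mono_on_image_pick(2) that by (intro minor_cong) auto
    also have "\<dots> = det (submatrix A ?I ?J)" using det_submatrix(1)[OF A IJ] by simp
    also have "\<dots> \<in> det_divisor k A"
      unfolding det_divisor_def genideal_class_ring using IJ A by blast
    finally show ?thesis .
  qed
  have rows: "minor A k f g \<in> det_divisor k A"
    if f: "f \<in> {0..<k} \<rightarrow> {0..<m}" "strict_mono_on {0..<k} f" and g: "g \<in> {0..<k} \<rightarrow> {0..<n}" for f g
  proof -
    have T: "minor (transpose_mat A) k h f = minor A k f h" if "h \<in> {0..<k} \<rightarrow> {0..<n}" for h
      by (rule minor_transpose[OF A that f(1)])
    consider c g' where "minor A k f g = c * minor A k f g'" "g' \<in> {0..<k} \<rightarrow> {0..<n}"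
        "strict_mono_on {0..<k} g'" | "minor A k f g = 0"
      using minor_rows_sorted[OF g, of "transpose_mat A" f] T g by metis
    thus ?thesis using sorted f ideal_mult_left[OF X] ideal_zero[OF X] by cases auto
  qed
  consider c f' where "minor A k f g = c * minor A k f' g" "f' \<in> {0..<k} \<rightarrow> {0..<m}"
        "strict_mono_on {0..<k} f'" | "minor A k f g = 0"
    using minor_rows_sorted[OF f, of A g] by metis
  thus ?thesis
  proof cases
    case 1
    thus ?thesis using rows[OF 1(2,3) g] ideal_mult_left[OF X] by simp
  qed (simp add: ideal_zero[OF X])
qed

lemma det_divisor_transpose:
  assumes A: "A \<in> carrier_mat m n"
  shows "det_divisor k (transpose_mat A) = det_divisor k A"
proof -
  have *: "det_divisor k (transpose_mat A) \<subseteq> det_divisor k A" if A: "A \<in> carrier_mat m n"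
    for A :: "'a mat" and m n
  proof (rule det_divisor_subsetI[OF _ det_divisor_ideal])
    show "transpose_mat A \<in> carrier_mat n m" using A by simp
    fix f g assume "f \<in> {0..<k} \<rightarrow> {0..<n}" "g \<in> {0..<k} \<rightarrow> {0..<m}"
    thus "minor (transpose_mat A) k f g \<in> det_divisor k A"
      using minor_in_det_divisor[OF A] minor_transpose[OF A] by simp
  qed
  show ?thesis using *[OF A] *[of "transpose_mat A" n m] A by auto
qed

text \<open>
  The formula of Cauchy and Binet before the terms with the same image of \<open>h\<close> are collected: the
  determinant is multilinear in the rows, and each row of \<open>A * B\<close> is a combination of rows of \<open>B\<close>.
\<close>

lemma minor_mult:
  assumes A: "A \<in> carrier_mat l m" and B: "B \<in> carrier_mat m n"
    and f: "f \<in> {0..<k} \<rightarrow> {0..<l}" and g: "g \<in> {0..<k} \<rightarrow> {0..<n}"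
  shows "minor (A * B) k f g =
    (\<Sum>h\<in>{0..<k} \<rightarrow>\<^sub>E {0..<m}. (\<Prod>i=0..<k. A $$ (f i, h i)) * minor B k h g)"
proof -
  have entry: "(A * B) $$ (f i, g j) = (\<Sum>h=0..<m. A $$ (f i, h) * B $$ (h, g j))"
    if "i < k" "j < k" for i j
    using A B f g that by (auto simp: scalar_prod_def Pi_iff)
  have "(\<Prod>i=0..<k. (A * B) $$ (f i, g (p i))) =
      (\<Sum>h\<in>{0..<k} \<rightarrow>\<^sub>E {0..<m}. \<Prod>i=0..<k. A $$ (f i, h i) * B $$ (h i, g (p i)))"
    if "p permutes {0..<k}" for p
  proof -
    have "(\<Prod>i=0..<k. (A * B) $$ (f i, g (p i))) =
        (\<Prod>i=0..<k. \<Sum>h=0..<m. A $$ (f i, h) * B $$ (h, g (p i)))"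
      using permutes_in_image[OF that] by (intro prod.cong refl entry) auto
    thus ?thesis by (simp add: prod_sum_PiE)
  qed
  hence "minor (A * B) k f g = (\<Sum>p | p permutes {0..<k}. \<Sum>h\<in>{0..<k} \<rightarrow>\<^sub>E {0..<m}.
      signof p * (\<Prod>i=0..<k. A $$ (f i, h i) * B $$ (h i, g (p i))))"
    unfolding minor_sum by (intro sum.cong refl) (simp add: sum_distrib_left)
  also have "\<dots> = (\<Sum>h\<in>{0..<k} \<rightarrow>\<^sub>E {0..<m}. \<Sum>p | p permutes {0..<k}.
      signof p * (\<Prod>i=0..<k. A $$ (f i, h i) * B $$ (h i, g (p i))))"
    by (rule sum.swap)
  also have "\<dots> = (\<Sum>h\<in>{0..<k} \<rightarrow>\<^sub>E {0..<m}. (\<Prod>i=0..<k. A $$ (f i, h i)) * minor B k h g)"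
    unfolding minor_sum sum_distrib_left prod.distrib
    by (intro sum.cong refl) (simp only: mult_ac)
  finally show ?thesis .
qed

lemma det_divisor_mult_right:
  assumes A: "A \<in> carrier_mat l m" and B: "B \<in> carrier_mat m n"
  shows "det_divisor k (A * B) \<subseteq> det_divisor k B"
proof (rule det_divisor_subsetI[OF _ det_divisor_ideal])
  show "A * B \<in> carrier_mat l n" using A B by simp
  fix f g assume fg: "f \<in> {0..<k} \<rightarrow> {0..<l}" "g \<in> {0..<k} \<rightarrow> {0..<n}"
  show "minor (A * B) k f g \<in> det_divisor k B"
    unfolding minor_mult[OF A B fg]
    by (intro ideal_sum ideal_mult_left det_divisor_ideal minor_in_det_divisor[OF B])
      (use fg in \<open>auto simp: PiE_iff\<close>)
qed

lemma det_divisor_mult_left: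
  assumes A: "A \<in> carrier_mat l m" and B: "B \<in> carrier_mat m n"
  shows "det_divisor k (A * B) \<subseteq> det_divisor k A"
proof -
  have "A * B \<in> carrier_mat l n" using A B by simp
  hence "det_divisor k (A * B) = det_divisor k (transpose_mat (A * B))"
    by (rule det_divisor_transpose[symmetric])
  also have "\<dots> = det_divisor k (transpose_mat B * transpose_mat A)"
    by (simp add: transpose_mult[OF A B])
  also have "\<dots> \<subseteq> det_divisor k (transpose_mat A)"
    by (rule det_divisor_mult_right[of _ n m _ l]) (use A B in auto)
  also have "\<dots> = det_divisor k A" by (rule det_divisor_transpose[OF A])
  finally show ?thesis .
qed

lemma minor_smult:
  assumes A: "A \<in> carrier_mat m n"
    and fg: "f \<in> {0..<k} \<rightarrow> {0..<m}" "g \<in> {0..<k} \<rightarrow> {0..<n}"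
  shows "minor (c \<cdot>\<^sub>m A) k f g = c ^ k * minor A k f g"
proof -
  have "mat k k (\<lambda>(i,j). (c \<cdot>\<^sub>m A) $$ (f i, g j)) = c \<cdot>\<^sub>m mat k k (\<lambda>(i,j). A $$ (f i, g j))"
    using A fg by (intro eq_matI) (auto simp: Pi_iff)
  thus ?thesis by (simp add: minor_def)
qed

lemma minor_scaled:
  "minor (mat m n (\<lambda>(i,j). D i * M $$ (i,j) * E j)) k f g =
     (\<Prod>i=0..<k. D (f i)) * minor M k f g * (\<Prod>i=0..<k. E (g i))"
  if fg: "f \<in> {0..<k} \<rightarrow> {0..<m}" "g \<in> {0..<k} \<rightarrow> {0..<n}"
proof -
  let ?A = "mat m n (\<lambda>(i,j). D i * M $$ (i,j) * E j)"
  have "(\<Prod>i=0..<k. ?A $$ (f i, g (p i))) =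
      (\<Prod>i=0..<k. D (f i)) * (\<Prod>i=0..<k. M $$ (f i, g (p i))) * (\<Prod>i=0..<k. E (g i))"
    if p: "p permutes {0..<k}" for p
  proof -
    have "(\<Prod>i=0..<k. ?A $$ (f i, g (p i))) =
        (\<Prod>i=0..<k. D (f i) * M $$ (f i, g (p i)) * E (g (p i)))"
      using permutes_in_image[OF p] fg by (intro prod.cong refl) (auto simp: Pi_iff)
    also have "\<dots> = (\<Prod>i=0..<k. D (f i)) * (\<Prod>i=0..<k. M $$ (f i, g (p i))) *
        (\<Prod>i=0..<k. E (g (p i)))" by (simp only: prod.distrib)
    also have "(\<Prod>i=0..<k. E (g (p i))) = (\<Prod>i=0..<k. E (g i))"
      using prod.permute[OF p, of "\<lambda>i. E (g i)"] by (simp add: o_def)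
    finally show ?thesis .
  qed
  thus ?thesis
    unfolding minor_sum sum_distrib_left sum_distrib_right
    by (intro sum.cong refl) (simp add: mult_ac)
qed

text \<open>
  The \<open>k\<close>-th minors of the scalar matrix \<open>A * adj A\<close> lie in the determinantal divisor of \<open>A\<close>, and one of
  them is the \<open>k\<close>-th power of the scalar.
\<close>

lemma det_power_in_det_divisor:
  assumes A: "A \<in> carrier_mat n n" and k: "k \<le> n"
  shows "det A ^ k \<in> det_divisor k A"
proof -
  let ?i = "\<lambda>i::nat. i"
  have i: "?i \<in> {0..<k} \<rightarrow> {0..<n}" using k by auto
  have 1: "minor (1\<^sub>m n :: 'a mat) k ?i ?i = 1"
  proof -
    have "mat k k (\<lambda>(i,j). (1\<^sub>m n :: 'a mat) $$ (i, j)) = 1\<^sub>m k" using k by (intro eq_matI) auto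
    thus ?thesis by (simp add: minor_def)
  qed
  have "det A ^ k = minor (det A \<cdot>\<^sub>m 1\<^sub>m n) k ?i ?i"
    by (subst minor_smult[OF _ i i]) (simp_all add: 1)
  also have "\<dots> \<in> det_divisor k (det A \<cdot>\<^sub>m 1\<^sub>m n)" by (rule minor_in_det_divisor[OF _ i i]) simp
  also have "det_divisor k (det A \<cdot>\<^sub>m 1\<^sub>m n) \<subseteq> det_divisor k A"
    unfolding adj_mat(2)[OF A, symmetric] by (rule det_divisor_mult_left[OF A adj_mat(1)[OF A]])
  finally show ?thesis .
qed

section \<open>Congruences in the special linear group\<close>

definition mat_in :: "'a set \<Rightarrow> 'a mat \<Rightarrow> bool" where
  "mat_in I A \<longleftrightarrow> (\<forall>i<dim_row A. \<forall>j<dim_col A. A $$ (i,j) \<in> I)"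

lemma mat_in_mult_left:
  assumes I: "is_ideal I" and A: "A \<in> carrier_mat l m" and B: "B \<in> carrier_mat m n" and "mat_in I A"
  shows "mat_in I (A * B)"
  using A B assms(4) unfolding mat_in_def
  by (auto simp: scalar_prod_def intro!: ideal_sum[OF I] ideal_mult_right[OF I])

lemma mat_in_mult_right:
  assumes I: "is_ideal I" and A: "A \<in> carrier_mat l m" and B: "B \<in> carrier_mat m n" and "mat_in I B"
  shows "mat_in I (A * B)"
  using A B assms(4) unfolding mat_in_def
  by (auto simp: scalar_prod_def intro!: ideal_sum[OF I] ideal_mult_left[OF I])

lemma mat_in_transpose: "mat_in I (transpose_mat A) \<longleftrightarrow> mat_in I A"
  unfolding mat_in_def by auto

definition mat_cong :: "'a::comm_ring_1 set \<Rightarrow> 'a mat \<Rightarrow> 'a mat \<Rightarrow> bool" where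
  "mat_cong I A B \<longleftrightarrow> mat_in I (A - B)"

lemma mat_cong_refl: "is_ideal I \<Longrightarrow> mat_cong I A A"
  by (simp add: mat_cong_def mat_in_def ideal_zero)

lemma mat_cong_transpose:
  "A \<in> carrier_mat m n \<Longrightarrow> B \<in> carrier_mat m n \<Longrightarrow>
    mat_cong I (transpose_mat A) (transpose_mat B) \<longleftrightarrow> mat_cong I A B"
  unfolding mat_cong_def mat_in_def by auto

lemma mat_cong_subset: "mat_cong I A B \<Longrightarrow> I \<subseteq> J \<Longrightarrow> mat_cong J A B"
  unfolding mat_cong_def mat_in_def by blast

lemma mat_cong_mult:
  assumes I: "is_ideal I"
    and A: "A \<in> carrier_mat l m" "A' \<in> carrier_mat l m" "mat_cong I A A'"
    and B: "B \<in> carrier_mat m n" "B' \<in> carrier_mat m n" "mat_cong I B B'"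
  shows "mat_cong I (A * B) (A' * B')"
proof -
  have "A * B - A' * B' = (A - A') * B + A' * (B - B')"
    using A B by (simp add: minus_mult_distrib_mat mult_minus_distrib_mat)
      (intro eq_matI; auto)
  moreover have "mat_in I ((A - A') * B)"
    by (rule mat_in_mult_left[OF I, of _ l m _ n]) (use A B in \<open>auto simp: mat_cong_def\<close>)
  moreover have "mat_in I (A' * (B - B'))"
    by (rule mat_in_mult_right[OF I, of _ l m _ n]) (use A B in \<open>auto simp: mat_cong_def\<close>)
  ultimately show ?thesis
    using A B unfolding mat_cong_def mat_in_def by (auto intro!: ideal_add[OF I])
qed

text \<open>
  The matrices that a path \<open>h\<close> inside the special linear group joins to the identity. The last
  condition is the only property of polynomial entries that matters: if \<open>c\<close> is congruent to \<open>0\<close> or to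
  \<open>1\<close> modulo an ideal, then \<open>h c\<close> is congruent to the identity or to \<open>W\<close>.
\<close>

definition sl_path :: "nat \<Rightarrow> 'a::comm_ring_1 mat \<Rightarrow> bool" where
  "sl_path n W \<longleftrightarrow> (\<exists>h. h 0 = 1\<^sub>m n \<and> h 1 = W \<and> (\<forall>c. h c \<in> carrier_mat n n \<and> det (h c) = 1) \<and>
     (\<forall>c d. mat_cong (range ((*) (c - d))) (h c) (h d)))"

lemma sl_path_carrier: "sl_path n W \<Longrightarrow> W \<in> carrier_mat n n"
  and sl_path_det: "sl_path n W \<Longrightarrow> det W = 1"
  by (auto simp: sl_path_def)

lemma sl_path_mult:
  assumes "sl_path n V" "sl_path n W"
  shows "sl_path n (V * W)"
proof -
  obtain g where g: "g 0 = 1\<^sub>m n" "g 1 = V" "\<And>c. g c \<in> carrier_mat n n" "\<And>c. det (g c) = 1"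
     "\<And>c d. mat_cong (range ((*) (c - d))) (g c) (g d)"
    using assms(1) unfolding sl_path_def by metis
  obtain h where h: "h 0 = 1\<^sub>m n" "h 1 = W" "\<And>c. h c \<in> carrier_mat n n" "\<And>c. det (h c) = 1"
     "\<And>c d. mat_cong (range ((*) (c - d))) (h c) (h d)"
    using assms(2) unfolding sl_path_def by metis
  have "mat_cong (range ((*) (c - d))) (g c * h c) (g d * h d)" for c d
    by (rule mat_cong_mult[OF principal_ideal g(3,3,5) h(3,3,5)])
  moreover have "g c * h c \<in> carrier_mat n n" "det (g c * h c) = 1" for c
    using g(3)[of c] h(3)[of c] g(4)[of c] h(4)[of c] by (simp_all add: det_mult[of _ n])
  ultimately show ?thesis
    unfolding sl_path_def using g h by (intro exI[of _ "\<lambda>c. g c * h c"]) simp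
qed

lemma sl_path_one: "sl_path n (1\<^sub>m n)"
  unfolding sl_path_def
  by (intro exI[of _ "\<lambda>_. 1\<^sub>m n"]) (simp add: mat_cong_refl principal_ideal)

lemma sl_path_transpose:
  assumes "sl_path n W"
  shows "sl_path n (transpose_mat W)"
proof -
  obtain h where h: "h 0 = 1\<^sub>m n" "h 1 = W" "\<And>c. h c \<in> carrier_mat n n" "\<And>c. det (h c) = 1"
     "\<And>c d. mat_cong (range ((*) (c - d))) (h c) (h d)"
    using assms unfolding sl_path_def by metis
  show ?thesis
    unfolding sl_path_def
    using h by (intro exI[of _ "\<lambda>c. transpose_mat (h c)"])
      (simp add: det_transpose[OF h(3)] mat_cong_transpose[OF h(3) h(3)])
qed

abbreviation block_diag1 :: "nat \<Rightarrow> 'a::comm_ring_1 mat \<Rightarrow> 'a mat" where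
  "block_diag1 n W \<equiv> four_block_mat (1\<^sub>m 1) (0\<^sub>m 1 n) (0\<^sub>m n 1) W"

lemma det_block_diag1:
  "W \<in> carrier_mat n n \<Longrightarrow> det (block_diag1 n W) = det (W :: 'a::idom mat)"
  by (subst det_four_block_mat_lower_left_zero[of _ 1 _ n]) auto

lemma sl_path_block:
  assumes "sl_path n (W :: 'a::idom mat)"
  shows "sl_path (Suc n) (block_diag1 n W)"
proof -
  obtain h where h: "h 0 = 1\<^sub>m n" "h 1 = W" "\<And>c. h c \<in> carrier_mat n n" "\<And>c. det (h c) = 1"
     "\<And>c d. mat_cong (range ((*) (c - d))) (h c) (h d)"
    using assms unfolding sl_path_def by metis
  let ?h = "\<lambda>c. block_diag1 n (h c)"
  have dim: "dim_row (h c) = n" "dim_col (h c) = n" for c using h(3)[of c] by auto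
  have carrier: "?h c \<in> carrier_mat (Suc n) (Suc n)" for c using h(3)[of c] by auto
  have "?h 0 = 1\<^sub>m (Suc n)" unfolding h(1) by (intro eq_matI) auto
  moreover have "det (?h c) = 1" for c using det_block_diag1[OF h(3)] h(4) by simp
  moreover have "mat_cong (range ((*) (c - d))) (?h c) (?h d)" for c d
  proof -
    have "(?h c - ?h d) $$ (i,j) \<in> range ((*) (c - d))" if ij: "i < Suc n" "j < Suc n" for i j
    proof (cases "i = 0 \<or> j = 0")
      case True
      hence "(?h c - ?h d) $$ (i,j) = 0" using ij dim by auto
      thus ?thesis using ideal_zero[OF principal_ideal] by simp
    next
      case False
      hence "(?h c - ?h d) $$ (i,j) = (h c - h d) $$ (i - 1, j - 1)" using ij dim by auto
      thus ?thesis using h(5)[of c d] False ij dim unfolding mat_cong_def mat_in_def by auto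
    qed
    thus ?thesis unfolding mat_cong_def mat_in_def using dim by simp
  qed
  ultimately show ?thesis unfolding sl_path_def using carrier h(2) by (intro exI[of _ ?h]) auto
qed

definition row_shear :: "nat \<Rightarrow> (nat \<Rightarrow> 'a::comm_ring_1) \<Rightarrow> 'a mat" where
  "row_shear n v = mat n n (\<lambda>(i,j). if i = j then 1 else if i = 0 then v j else 0)"

lemma row_shear_carrier [simp]: "row_shear n v \<in> carrier_mat n n"
  by (simp add: row_shear_def)

lemma sl_path_row_shear: "sl_path n (row_shear n v)"
proof -
  let ?h = "\<lambda>c. row_shear n (\<lambda>j. c * v j)"
  have "det (row_shear n w) = 1" for w :: "nat \<Rightarrow> 'a"
  proof -
    have "upper_triangular (row_shear n w)" by (auto simp: row_shear_def)
    hence "det (row_shear n w) = prod_list (diag_mat (row_shear n w))"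
      by (rule det_upper_triangular[OF _ row_shear_carrier])
    also have "diag_mat (row_shear n w) = map (\<lambda>_. 1) [0..<n]"
      by (auto simp: diag_mat_def row_shear_def)
    also have "prod_list \<dots> = (1 :: 'a)" by (induction n) auto
    finally show ?thesis .
  qed
  moreover have "?h 0 = 1\<^sub>m n" by (intro eq_matI) (auto simp: row_shear_def)
  moreover have "mat_cong (range ((*) (c - d))) (?h c) (?h d)" for c d
    unfolding mat_cong_def mat_in_def using ideal_zero[OF principal_ideal, of "c - d"]
    by (auto simp: row_shear_def left_diff_distrib[symmetric])
  ultimately show ?thesis unfolding sl_path_def by (intro exI[of _ ?h]) simp
qed

lemma row_shear_mult:
  assumes A: "A \<in> carrier_mat n m" and ij: "i < n" "j < m"
  shows "(row_shear n v * A) $$ (i,j) =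
    A $$ (i,j) + (if i = 0 then \<Sum>l\<in>{1..<n}. v l * A $$ (l,j) else 0)"
proof -
  have "(row_shear n v * A) $$ (i,j) =
      (\<Sum>l=0..<n. (if i = l then 1 else if i = 0 then v l else 0) * A $$ (l,j))"
    using A ij by (auto simp: row_shear_def scalar_prod_def)
  also have "\<dots> = A $$ (i,j) + (\<Sum>l\<in>{0..<n} - {i}. (if i = 0 then v l else 0) * A $$ (l,j))"
    using ij by (subst sum.remove[of _ i]) (auto intro!: sum.cong)
  also have "(\<Sum>l\<in>{0..<n} - {i}. (if i = 0 then v l else 0) * A $$ (l,j)) =
      (if i = 0 then \<Sum>l\<in>{1..<n}. v l * A $$ (l,j) else 0)"
    by (auto intro!: sum.cong)
  finally show ?thesis .
qed

text \<open>
  For each \<open>Q\<close> in \<open>S\<close> there is an element of \<open>Q\<close> that is congruent to \<open>1\<close> modulo \<open>P\<close>; multiply them.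
\<close>

lemma ex_crt_idempotent:
  assumes S: "finite S" "\<And>Q. Q \<in> S \<Longrightarrow> is_maximal (Q :: 'a::comm_ring_1 set)" and P: "is_maximal P" "P \<notin> S"
  shows "\<exists>c. c - 1 \<in> P \<and> (\<forall>Q\<in>S. c \<in> Q)"
  using S P(2)
proof (induction S rule: finite_induct)
  case empty
  show ?case using ideal_zero[OF maximal_ideal[OF P(1)]] by (intro exI[of _ 1]) simp
next
  case (insert Q S)
  obtain c where c: "c - 1 \<in> P" "\<forall>R\<in>S. c \<in> R" using insert by auto
  have Q: "is_maximal Q" "Q \<noteq> P" using insert.prems by auto
  hence "\<not> Q \<subseteq> P"
    using maximal_subset_eq[OF Q(1) maximal_ideal[OF P(1)] maximal_one[OF P(1)]] by blast
  then obtain x where x: "x \<in> Q" "x \<notin> P" by blast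
  then obtain y where y: "x * y - 1 \<in> P" using maximal_inverse[OF P(1)] by blast
  have "c * (x * y) - 1 = c * (x * y - 1) + (c - 1)" by (simp add: algebra_simps)
  also have "\<dots> \<in> P"
    by (intro ideal_add ideal_mult_left maximal_ideal P(1) y c(1))
  finally have "c * (x * y) - 1 \<in> P" .
  moreover have "c * (x * y) \<in> R" if "R \<in> insert Q S" for R
  proof (cases "R = Q")
    case True
    thus ?thesis using ideal_mult_left[OF maximal_ideal[OF Q(1)] ideal_mult_right[OF maximal_ideal[OF Q(1)] x(1)]]
      by simp
  next
    case False
    hence "R \<in> S" using that by simp
    hence "c \<in> R" "is_ideal R" using c(2) insert.prems(1)[of R] maximal_ideal by auto
    thus ?thesis by (rule ideal_mult_right[rotated])
  qed
  ultimately show ?case by blast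
qed

text \<open>
  For each \<open>P\<close>, evaluate the path of \<open>W P\<close> at a parameter that is \<open>1\<close> modulo \<open>P\<close> and \<open>0\<close> modulo the other
  members of \<open>S\<close>. The product of the resulting matrices satisfies all congruences.
\<close>

lemma sl_path_simultaneous:
  assumes S: "finite S" "\<And>P. P \<in> S \<Longrightarrow> is_maximal P"
    and W: "\<And>P. P \<in> S \<Longrightarrow> sl_path n (W P)"
  shows "\<exists>V \<in> carrier_mat n n. det V = 1 \<and> (\<forall>P\<in>S. mat_cong P V (W P))"
proof -
  have "\<exists>V \<in> carrier_mat n n. det V = 1 \<and> (\<forall>P\<in>T. mat_cong P V (W P)) \<and>
      (\<forall>P\<in>S - T. mat_cong P V (1\<^sub>m n))" if "finite T" "T \<subseteq> S" for T
    using that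
  proof (induction T rule: finite_induct)
    case empty
    show ?case
      by (intro bexI[of _ "1\<^sub>m n"]) (auto intro!: mat_cong_refl maximal_ideal S(2))
  next
    case (insert P T)
    obtain V where V: "V \<in> carrier_mat n n" "det V = 1" "\<forall>P\<in>T. mat_cong P V (W P)"
        "\<forall>P\<in>S - T. mat_cong P V (1\<^sub>m n)" using insert by auto
    have P: "P \<in> S" "P \<notin> T" using insert by auto
    obtain h where h: "h 0 = 1\<^sub>m n" "h 1 = W P" "\<And>c. h c \<in> carrier_mat n n" "\<And>c. det (h c) = 1"
        "\<And>c d. mat_cong (range ((*) (c - d))) (h c) (h d)"
      using W[OF P(1)] unfolding sl_path_def by metis
    obtain c where c: "c - 1 \<in> P" "\<forall>Q\<in>S - {P}. c \<in> Q"
      using ex_crt_idempotent[of "S - {P}" P] S P(1) by auto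
    have hP: "mat_cong P (h c) (W P)"
      using mat_cong_subset[OF h(5)[of c 1], of P] h(2)
        ideal_mult_right[OF maximal_ideal[OF S(2)[OF P(1)]] c(1)] by auto
    have hQ: "mat_cong Q (h c) (1\<^sub>m n)" if "Q \<in> S" "Q \<noteq> P" for Q
      using mat_cong_subset[OF h(5)[of c 0], of Q] h(1) c(2) that
        ideal_mult_right[OF maximal_ideal[OF S(2)[OF that(1)]], of c] by auto
    have mult: "mat_cong Q (V * h c) (V' * H)"
      if "Q \<in> S" "mat_cong Q V V'" "mat_cong Q (h c) H" "V' \<in> carrier_mat n n" "H \<in> carrier_mat n n"
      for Q V' H
      using mat_cong_mult[OF maximal_ideal[OF S(2)[OF that(1)]] V(1) that(4,2) h(3) that(5,3)] .
    have one: "1\<^sub>m n \<in> carrier_mat n n" by simp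
    note carr = sl_path_carrier[OF W]
    have "mat_cong Q (V * h c) (W Q)" if "Q \<in> insert P T" for Q
    proof (cases "Q = P")
      case True
      thus ?thesis using mult[OF P(1), of "1\<^sub>m n" "W P"] V(4) P hP carr[OF P(1)] by simp
    next
      case False
      hence "Q \<in> T" "Q \<in> S" using that insert.prems by auto
      thus ?thesis using mult[of Q "W Q" "1\<^sub>m n"] V(3) hQ False carr[of Q] by simp
    qed
    moreover have "mat_cong Q (V * h c) (1\<^sub>m n)" if "Q \<in> S - insert P T" for Q
      using mult[of Q "1\<^sub>m n" "1\<^sub>m n"] V(4) hQ that by simp
    moreover have "det (V * h c) = 1" using V h(3,4) by (simp add: det_mult[of _ n])
    moreover have "V * h c \<in> carrier_mat n n" using V(1) h(3)[of c] by simp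
    ultimately show ?case by blast
  qed
  from this[of S] S(1) show ?thesis by auto
qed

section \<open>Smith form in the local ring\<close>

lemma ldvd_ideal: "is_maximal P \<Longrightarrow> is_ideal {y. ldvd P x y}"
  by (simp add: ldvd_def sat_ideal principal_ideal)

lemma ldvd_dvd: "is_maximal P \<Longrightarrow> x dvd y \<Longrightarrow> ldvd P x y"
  unfolding ldvd_iff using maximal_one by (fastforce elim!: dvdE intro: exI[of _ 1])

lemma ldvd_trans:
  assumes "is_maximal P" "ldvd P x y" "ldvd P y z"
  shows "ldvd P x z"
  using sat_memI[OF assms(1) principal_ideal] assms(2,3) unfolding ldvd_def by blast

lemma ldvd_mult:
  assumes P: "is_maximal P" and "ldvd P a b" "ldvd P c d"
  shows "ldvd P (a * c) (b * d)"
proof -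
  obtain s u where s: "s \<notin> P" "s * b = a * u" using assms(2) by (auto simp: ldvd_iff)
  obtain t v where t: "t \<notin> P" "t * d = c * v" using assms(3) by (auto simp: ldvd_iff)
  have "(s * t) * (b * d) = (s * b) * (t * d)" by (simp only: mult_ac)
  also have "\<dots> = (a * u) * (c * v)" by (simp only: s(2) t(2))
  also have "\<dots> = (a * c) * (u * v)" by (simp only: mult_ac)
  finally show ?thesis unfolding ldvd_iff using maximal_mult[OF P s(1) t(1)] by blast
qed

lemma ldvd_prod:
  assumes P: "is_maximal P" and "\<And>i. i \<in> F \<Longrightarrow> ldvd P (f i) (g i)"
  shows "ldvd P (prod f F) (prod g F)"
  using assms(2)
proof (induction F rule: infinite_finite_induct)
  case (insert x F)
  thus ?case using ldvd_mult[OF P, of "f x" "g x" "prod f F" "prod g F"] by simp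
qed (simp_all add: ldvd_dvd[OF P])

lemma ldvd_cancel: "is_maximal P \<Longrightarrow> s \<notin> P \<Longrightarrow> ldvd P x (s * y) \<Longrightarrow> ldvd P x y"
  unfolding ldvd_def by (rule sat_cancel)

text \<open>
  The ultrametric principle: a sum with one term of strictly smallest valuation has that valuation.
\<close>

lemma ldvd_add_strict:
  assumes P: "is_maximal P" and xy: "\<not> ldvd P x y" "ldvd P y x"
  shows "ldvd P (x + y) y"
proof -
  note I = maximal_ideal[OF P]
  obtain s c where s: "s \<notin> P" "s * x = y * c" using xy(2) by (auto simp: ldvd_iff)
  have "c \<in> P"
  proof (rule ccontr)
    assume "c \<notin> P"
    moreover have "c * y = x * s" using s(2) by (simp add: mult.commute)
    ultimately show False using xy(1) by (auto simp: ldvd_iff)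
  qed
  have "c + s \<notin> P"
  proof
    assume "c + s \<in> P"
    hence "(c + s) - c \<in> P" using ideal_diff[OF I] \<open>c \<in> P\<close> by blast
    thus False using s(1) by simp
  qed
  moreover have "(c + s) * y = (x + y) * s" using s(2) by (simp add: algebra_simps)
  ultimately show ?thesis by (auto simp: ldvd_iff)
qed

lemma ldvd_least:
  assumes P: "is_maximal P" and tot: "\<And>x y. ldvd P x y \<or> ldvd P y x"
    and "finite F" "F \<noteq> {}"
  shows "\<exists>a\<in>F. \<forall>b\<in>F. ldvd P a b"
  using assms(3,4)
proof (induction F rule: finite_ne_induct)
  case (singleton x)
  show ?case using ldvd_dvd[OF P] by auto
next
  case (insert x F)
  obtain a where a: "a \<in> F" "\<forall>b\<in>F. ldvd P a b" using insert by auto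
  show ?case
  proof (cases "ldvd P a x")
    case True
    thus ?thesis using a by auto
  next
    case False
    hence "ldvd P x a" using tot by blast
    hence "\<forall>b\<in>F. ldvd P x b" using a(2) ldvd_trans[OF P] by blast
    thus ?thesis using ldvd_dvd[OF P, of x x] by auto
  qed
qed

lemma common_denominator:
  assumes P: "is_maximal P" and "finite F" "\<And>b. b \<in> F \<Longrightarrow> ldvd P a b"
  shows "\<exists>s. s \<notin> P \<and> (\<forall>b\<in>F. a dvd s * b)"
  using assms(2,3)
proof (induction F rule: finite_induct)
  case empty
  show ?case using maximal_one[OF P] by auto
next
  case (insert b F)
  obtain s where s: "s \<notin> P" "\<forall>b\<in>F. a dvd s * b" using insert by auto
  obtain t where t: "t \<notin> P" "a dvd t * b" using insert.prems[of b] by (auto simp: ldvd_iff)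
  have "a dvd (s * t) * c" if "c \<in> insert b F" for c
  proof (cases "c = b")
    case True
    have "a dvd s * (t * b)" using t(2) by simp
    thus ?thesis using True by (simp add: mult.assoc)
  next
    case False
    hence "a dvd t * (s * c)" using s(2) that by simp
    thus ?thesis by (simp add: mult_ac)
  qed
  thus ?case using maximal_mult[OF P s(1) t(1)] by blast
qed

lemma finite_entries: "finite {A $$ (i,j) | i j. i < m \<and> j < n}"
proof -
  have "{A $$ (i,j) | i j. i < m \<and> j < n} = (\<lambda>(i,j). A $$ (i,j)) ` ({..<m} \<times> {..<n})" by auto
  thus ?thesis by simp
qed

text \<open>
  A row exchange has determinant \<open>-1\<close>, so a shear has to do its work: if the entry in row \<open>0\<close> is not
  yet least, its valuation exceeds that of the least entry in row \<open>p\<close>, and adding row \<open>p\<close> makes row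
  \<open>0\<close> contain a least entry.
\<close>

lemma move_pivot_row:
  assumes P: "is_maximal P"
    and A: "A \<in> carrier_mat n m" and pq: "p < n" "q < m"
    and least: "mat_in {y. ldvd P (A $$ (p,q)) y} A"
    and tot: "\<And>x y. ldvd P x y \<or> ldvd P y x"
  shows "\<exists>R. sl_path n R \<and> mat_in {y. ldvd P ((R * A) $$ (0,q)) y} (R * A)"
proof -
  let ?shear = "\<lambda>t. row_shear n (\<lambda>j. if j = p then t else 0)"
  have "\<exists>R. sl_path n R \<and> ldvd P ((R * A) $$ (0,q)) (A $$ (p,q))"
  proof (cases "p = 0 \<or> ldvd P (A $$ (0,q)) (A $$ (p,q))")
    case True
    thus ?thesis using ldvd_dvd[OF P, of "A $$ (p,q)"] A sl_path_one
      by (intro exI[of _ "1\<^sub>m n"]) auto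
  next
    case False
    have "(?shear 1 * A) $$ (0,q) = A $$ (0,q) +
        (\<Sum>l\<in>{1..<n}. (if l = p then 1 else 0) * A $$ (l,q))"
      using row_shear_mult[OF A _ pq(2), of 0] pq by simp
    also have "(\<Sum>l\<in>{1..<n}. (if l = p then 1 else 0) * A $$ (l,q)) =
        (\<Sum>l\<in>{1..<n}. if l = p then A $$ (p,q) else 0)"
      by (intro sum.cong) auto
    also have "\<dots> = A $$ (p,q)" using False pq by simp
    finally have "(?shear 1 * A) $$ (0,q) = A $$ (0,q) + A $$ (p,q)" .
    moreover have "ldvd P (A $$ (p,q)) (A $$ (0,q))"
      using least A pq unfolding mat_in_def by auto
    ultimately have "ldvd P ((?shear 1 * A) $$ (0,q)) (A $$ (p,q))"
      using ldvd_add_strict[OF P] False by simp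
    thus ?thesis using sl_path_row_shear by blast
  qed
  then obtain R where R: "sl_path n R" "ldvd P ((R * A) $$ (0,q)) (A $$ (p,q))" by blast
  have "mat_in {y. ldvd P ((R * A) $$ (0,q)) y} A"
    using least ldvd_trans[OF P R(2)] unfolding mat_in_def by auto
  hence "mat_in {y. ldvd P ((R * A) $$ (0,q)) y} (R * A)"
    by (rule mat_in_mult_right[OF ldvd_ideal[OF P] sl_path_carrier[OF R(1)] A])
  thus ?thesis using R(1) by blast
qed

lemma move_pivot:
  assumes P: "is_maximal P"
    and A: "A \<in> carrier_mat n n" and n: "n > 0"
    and tot: "\<And>x y. ldvd P x y \<or> ldvd P y x"
  shows "\<exists>R S. sl_path n R \<and> sl_path n S \<and>
    mat_in {y. ldvd P ((R * A * S) $$ (0,0)) y} (R * A * S)"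
proof -
  let ?F = "{A $$ (i,j) | i j. i < n \<and> j < n}"
  have "?F \<noteq> {}" using n by auto
  then obtain a where a: "a \<in> ?F" "\<forall>b\<in>?F. ldvd P a b"
    using ldvd_least[OF P tot finite_entries] by blast
  then obtain p q where pq: "p < n" "q < n" "a = A $$ (p,q)" by blast
  have "mat_in {y. ldvd P (A $$ (p,q)) y} A" using a(2) pq(3) A unfolding mat_in_def by auto
  then obtain R where R: "sl_path n R" "mat_in {y. ldvd P ((R * A) $$ (0,q)) y} (R * A)"
    using move_pivot_row[OF P A pq(1,2) _ tot] by blast
  let ?B = "transpose_mat (R * A)"
  have RA: "R * A \<in> carrier_mat n n" using sl_path_carrier[OF R(1)] A by simp
  hence B: "?B \<in> carrier_mat n n" by simp
  have "?B $$ (q,0) = (R * A) $$ (0,q)" using A sl_path_carrier[OF R(1)] pq n by simp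
  hence "mat_in {y. ldvd P (?B $$ (q,0)) y} ?B"
    using R(2) by (simp add: mat_in_transpose)
  then obtain S where S: "sl_path n S" "mat_in {y. ldvd P ((S * ?B) $$ (0,0)) y} (S * ?B)"
    using move_pivot_row[OF P B pq(2) n _ tot] by blast
  have Sc: "S \<in> carrier_mat n n" by (rule sl_path_carrier[OF S(1)])
  have eq: "S * ?B = transpose_mat (R * A * transpose_mat S)"
    using Sc by (subst transpose_mult[OF RA]) auto
  have RAS: "R * A * transpose_mat S \<in> carrier_mat n n" using RA Sc by simp
  have "(S * ?B) $$ (0,0) = (R * A * transpose_mat S) $$ (0,0)"
    unfolding eq using A sl_path_carrier[OF R(1)] Sc n by simp
  hence "mat_in {y. ldvd P ((R * A * transpose_mat S) $$ (0,0)) y} (R * A * transpose_mat S)"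
    using S(2) unfolding eq mat_in_transpose by simp
  thus ?thesis using R(1) sl_path_transpose[OF S(1)] by blast
qed

lemma mult_row_shear:
  assumes A: "A \<in> carrier_mat m n" and ij: "i < m" "j < n"
  shows "(A * row_shear n v) $$ (i,j) = A $$ (i,j) + (if j = 0 then 0 else A $$ (i,0) * v j)"
proof -
  have "(A * row_shear n v) $$ (i,j) =
      (\<Sum>l=0..<n. A $$ (i,l) * (if l = j then 1 else if l = 0 then v j else 0))"
    using A ij by (auto simp: row_shear_def scalar_prod_def)
  also have "\<dots> = A $$ (i,j) + (\<Sum>l\<in>{0..<n} - {j}. A $$ (i,l) * (if l = 0 then v j else 0))"
    using ij by (subst sum.remove[of _ j]) (auto intro!: sum.cong)
  also have "(\<Sum>l\<in>{0..<n} - {j}. A $$ (i,l) * (if l = 0 then v j else 0)) =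
      (\<Sum>l\<in>{0..<n} - {j}. if l = 0 then A $$ (i,0) * v j else 0)"
    by (intro sum.cong) auto
  also have "\<dots> = (if j = 0 then 0 else A $$ (i,0) * v j)" using ij by auto
  finally show ?thesis .
qed

text \<open>
  The two sides are treated differently. Row operations may multiply by denominators outside \<open>P\<close>, so
  the first column is cleared exactly. Column operations must be shears over the ring itself; with an
  inverse \<open>s'\<close> of the denominator \<open>s\<close> modulo \<open>P\<close> they leave in the first row multiples of the pivot by
  elements of \<open>P\<close>.
\<close>

lemma clear_first_row_col:
  assumes P: "is_maximal P"
    and A: "A \<in> carrier_mat (Suc m) (Suc m)"
    and least: "mat_in {y. ldvd P (A $$ (0,0)) y} (A :: 'a::idom mat)"
  shows "\<exists>X Y s \<rho> A'. X \<in> carrier_mat (Suc m) (Suc m) \<and> det X \<notin> P \<and> sl_path (Suc m) Y \<and> s \<notin> P \<and>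
    \<rho> \<in> carrier_mat 1 m \<and> mat_in P \<rho> \<and> A' \<in> carrier_mat m m \<and>
    mat_in {y. ldvd P (A $$ (0,0)) y} A' \<and>
    X * A * Y = four_block_mat (mat 1 1 (\<lambda>_. A $$ (0,0) * s)) (A $$ (0,0) \<cdot>\<^sub>m \<rho>) (0\<^sub>m m 1) A'"
proof -
  let ?n = "Suc m"
  define a where "a = A $$ (0,0)"
  note I = maximal_ideal[OF P]
  let ?F = "{A $$ (i,j) | i j. i < ?n \<and> j < ?n}"
  obtain s where s: "s \<notin> P" "\<forall>b\<in>?F. a dvd s * b"
    using common_denominator[OF P finite_entries, of A ?n ?n a] least A
    unfolding mat_in_def a_def by auto
  have "\<exists>c. s * A $$ (i,j) = a * c" if "i < ?n" "j < ?n" for i j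
    using s(2) that by (auto elim!: dvdE)
  then obtain c where c: "\<And>i j. i < ?n \<Longrightarrow> j < ?n \<Longrightarrow> s * A $$ (i,j) = a * c i j" by metis
  obtain s' where s': "s * s' - 1 \<in> P" using maximal_inverse[OF P s(1)] by blast
  define X where "X = mat ?n ?n (\<lambda>(i,j). if i = j then s else if j = 0 then - c i 0 else 0)"
  have X: "X \<in> carrier_mat ?n ?n" by (simp add: X_def)
  have "det X = prod_list (diag_mat X)"
    by (rule det_lower_triangular[OF _ X]) (auto simp: X_def)
  also have "diag_mat X = replicate ?n s"
    by (auto simp: diag_mat_def X_def map_replicate_const[symmetric] simp del: upt_Suc replicate_Suc
        intro!: nth_equalityI)
  finally have detX: "det X \<notin> P" using maximal_power[OF P s(1), of ?n] by simp
  have XA: "X * A \<in> carrier_mat ?n ?n" using X A by simp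
  have XA_entry: "(X * A) $$ (i,j) = s * A $$ (i,j) - (if i = 0 then 0 else c i 0 * A $$ (0,j))"
    if ij: "i < ?n" "j < ?n" for i j
  proof -
    have "(X * A) $$ (i,j) =
        (\<Sum>l=0..<?n. (if i = l then s else if l = 0 then - c i 0 else 0) * A $$ (l,j))"
      using A ij by (auto simp: X_def scalar_prod_def)
    also have "\<dots> = s * A $$ (i,j) +
        (\<Sum>l\<in>{0..<?n} - {i}. (if l = 0 then - c i 0 else 0) * A $$ (l,j))"
      using ij by (subst sum.remove[of _ i]) (auto intro!: sum.cong)
    also have "(\<Sum>l\<in>{0..<?n} - {i}. (if l = 0 then - c i 0 else 0) * A $$ (l,j)) =
        (\<Sum>l\<in>{0..<?n} - {i}. if l = 0 then - c i 0 * A $$ (0,j) else 0)"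
      by (intro sum.cong) auto
    also have "\<dots> = - (if i = 0 then 0 else c i 0 * A $$ (0,j))" by auto
    finally show ?thesis by simp
  qed
  have row0: "(X * A) $$ (0,j) = a * c 0 j" if "j < ?n" for j
    using XA_entry[of 0 j] c[of 0 j] that by simp
  have col0: "(X * A) $$ (i,0) = 0" if "0 < i" "i < ?n" for i
    using XA_entry[of i 0] c[of i 0] that by (simp add: a_def mult.commute)
  \<comment> \<open>Adding \<open>v j\<close> times the pivot column turns the entry \<open>a * c 0 j\<close> of the first row into
    \<open>a * (1 - s * s') * c 0 j\<close>.\<close>
  define v where "v = (\<lambda>j. - (s' * c 0 j))"
  define Y where "Y = row_shear ?n v"
  have Y: "sl_path ?n Y" "Y \<in> carrier_mat ?n ?n"
    by (simp_all add: Y_def sl_path_row_shear)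
  have XAY_entry: "(X * A * Y) $$ (i,j) = (X * A) $$ (i,j) +
      (if j = 0 then 0 else (X * A) $$ (i,0) * v j)" if ij: "i < ?n" "j < ?n" for i j
    unfolding Y_def using mult_row_shear[OF XA ij] by simp
  define \<rho> where "\<rho> = mat 1 m (\<lambda>(i,j). - c 0 (Suc j) * (s * s' - 1))"
  define A' where "A' = mat m m (\<lambda>(i,j). (X * A) $$ (Suc i, Suc j))"
  have c00: "a * c 0 0 = a * s" using c[of 0 0] unfolding a_def by (metis mult.commute zero_less_Suc)
  have XAY: "X * A * Y = four_block_mat (mat 1 1 (\<lambda>_. a * s)) (a \<cdot>\<^sub>m \<rho>) (0\<^sub>m m 1) A'" (is "_ = ?T")
  proof (rule eq_matI)
    show "dim_row (X * A * Y) = dim_row ?T" "dim_col (X * A * Y) = dim_col ?T"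
      using X Y(2) by (auto simp: A'_def)
    fix i j assume "i < dim_row ?T" "j < dim_col ?T"
    hence ij: "i < ?n" "j < ?n" by (auto simp: A'_def)
    show "(X * A * Y) $$ (i,j) = ?T $$ (i,j)"
    proof (cases "i = 0")
      case True
      show ?thesis
      proof (cases "j = 0")
        case j: False
        have "(X * A * Y) $$ (0,j) = a * c 0 j + (a * c 0 0) * v j"
          using XAY_entry[of 0 j] row0 ij j by simp
        also have "\<dots> = a * (- c 0 j * (s * s' - 1))"
          unfolding c00 v_def by (simp add: algebra_simps)
        finally show ?thesis using True j ij by (simp add: A'_def \<rho>_def)
      qed (use True ij XAY_entry row0 c00 in \<open>simp add: A'_def \<rho>_def\<close>)
    next
      case False
      thus ?thesis
        using XAY_entry[OF ij] col0[of i] ij by (cases "j = 0") (simp_all add: A'_def \<rho>_def)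
    qed
  qed
  have "mat_in P \<rho>"
  proof -
    have "- c 0 (Suc j) * (s * s' - 1) \<in> P" for j by (rule ideal_mult_left[OF I s'])
    thus ?thesis by (simp add: mat_in_def \<rho>_def)
  qed
  moreover have "mat_in {y. ldvd P a y} A'"
  proof -
    have "mat_in {y. ldvd P a y} (X * A)"
      by (rule mat_in_mult_right[OF ldvd_ideal[OF P] X A]) (use least in \<open>simp add: a_def\<close>)
    thus ?thesis using X A unfolding mat_in_def A'_def by auto
  qed
  moreover have "\<rho> \<in> carrier_mat 1 m" "A' \<in> carrier_mat m m" by (simp_all add: \<rho>_def A'_def)
  ultimately show ?thesis
    using X detX Y(1) s(1) XAY unfolding a_def by blast
qed

text \<open>
  The matrices whose reduction modulo \<open>P\<close> is an invertible diagonal matrix.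
\<close>

definition unit_diag :: "'a::comm_ring_1 set \<Rightarrow> nat \<Rightarrow> 'a mat \<Rightarrow> bool" where
  "unit_diag P n M \<longleftrightarrow> M \<in> carrier_mat n n \<and> (\<forall>i<n. M $$ (i,i) \<notin> P) \<and>
     (\<forall>i<n. \<forall>j<n. i \<noteq> j \<longrightarrow> M $$ (i,j) \<in> P)"

text \<open>
  Smith's normal form over the valuation ring at \<open>P\<close>, with denominators confined to the left factor and
  an error \<open>\<tau>\<close> in exchange. Clear the first row and column around a least entry and continue with the
  remaining block; its entries stay divisible by the pivot, which gives the divisibility chain.
\<close>

lemma local_smith_form:
  assumes P: "is_maximal P" and tot: "\<And>x y. ldvd P x y \<or> ldvd P y x"
    and A: "A \<in> carrier_mat n n"
  shows "\<exists>X Y D \<tau>. X \<in> carrier_mat n n \<and> det X \<notin> P \<and> sl_path n Y \<and> unit_diag P n \<tau> \<and>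
    X * A * Y = mat n n (\<lambda>(i,j). D i * \<tau> $$ (i,j)) \<and>
    (\<forall>i j. i \<le> j \<longrightarrow> j < n \<longrightarrow> ldvd P (D i) (D j :: 'a::idom))"
  using A
proof (induction n arbitrary: A)
  case 0
  have "det (1\<^sub>m 0 :: 'a mat) \<notin> P" using maximal_one[OF P] by simp
  moreover have "1\<^sub>m 0 * A * 1\<^sub>m 0 = mat 0 0 (\<lambda>(i,j). 0 * (1\<^sub>m 0) $$ (i,j))"
    using 0 by (intro eq_matI) auto
  ultimately show ?case
    using sl_path_one[of 0]
    by (intro exI[of _ "1\<^sub>m 0"] exI[of _ "\<lambda>_. 0"]) (auto simp: unit_diag_def)
next
  case (Suc m)
  let ?n = "Suc m"
  note I = maximal_ideal[OF P]
  obtain R S where RS: "sl_path ?n R" "sl_path ?n S"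
      "mat_in {y. ldvd P ((R * A * S) $$ (0,0)) y} (R * A * S)"
    using move_pivot[OF P Suc.prems _ tot] by blast
  note Rc = sl_path_carrier[OF RS(1)] and Sc = sl_path_carrier[OF RS(2)]
  define B where "B = R * A * S"
  have B: "B \<in> carrier_mat ?n ?n" using Rc Sc Suc.prems by (simp add: B_def)
  define a where "a = B $$ (0,0)"
  obtain X1 Y1 s \<rho> A' where 1: "X1 \<in> carrier_mat ?n ?n" "det X1 \<notin> P" "sl_path ?n Y1" "s \<notin> P"
      "\<rho> \<in> carrier_mat 1 m" "mat_in P \<rho>" "A' \<in> carrier_mat m m" "mat_in {y. ldvd P a y} A'"
      "X1 * B * Y1 = four_block_mat (mat 1 1 (\<lambda>_. a * s)) (a \<cdot>\<^sub>m \<rho>) (0\<^sub>m m 1) A'"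
    using clear_first_row_col[OF P B] RS(3) unfolding B_def[symmetric] a_def by blast
  obtain X' Y' D' \<tau>' where 2: "X' \<in> carrier_mat m m" "det X' \<notin> P" "sl_path m Y'" "unit_diag P m \<tau>'"
      "X' * A' * Y' = mat m m (\<lambda>(i,j). D' i * \<tau>' $$ (i,j))"
      "\<forall>i j. i \<le> j \<longrightarrow> j < m \<longrightarrow> ldvd P (D' i) (D' j)"
    using Suc.IH[OF 1(7)] by blast
  note Y1c = sl_path_carrier[OF 1(3)] and Y'c = sl_path_carrier[OF 2(3)]
  have \<tau>': "\<tau>' \<in> carrier_mat m m" using 2(4) by (simp add: unit_diag_def)
  let ?X2 = "block_diag1 m X'" and ?Y2 = "block_diag1 m Y'"
  have X2: "?X2 \<in> carrier_mat ?n ?n" and Y2: "?Y2 \<in> carrier_mat ?n ?n" using 2(1) Y'c by auto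
  define X where "X = ?X2 * X1 * R"
  define Y where "Y = S * Y1 * ?Y2"
  define D where "D = case_nat a D'"
  define \<tau> where "\<tau> = four_block_mat (mat 1 1 (\<lambda>_. s)) (\<rho> * Y') (0\<^sub>m m 1) \<tau>'"
  have \<rho>Yc: "\<rho> * Y' \<in> carrier_mat 1 m" using 1(5) Y'c by simp
  moreover have "mat_in P (\<rho> * Y')" by (rule mat_in_mult_left[OF I 1(5) Y'c 1(6)])
  ultimately have \<rho>Y: "\<rho> * Y' \<in> carrier_mat 1 m" "\<And>j. j < m \<Longrightarrow> (\<rho> * Y') $$ (0,j) \<in> P"
    unfolding mat_in_def carrier_mat_def by auto
  have "X \<in> carrier_mat ?n ?n" using X2 1(1) Rc by (simp add: X_def)
  moreover have "det X \<notin> P"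
  proof -
    have "det X = det X' * det X1"
      unfolding X_def using X2 1(1) Rc sl_path_det[OF RS(1)] det_block_diag1[OF 2(1)]
      by (simp add: det_mult[of _ ?n])
    thus ?thesis using maximal_mult[OF P 2(2) 1(2)] by simp
  qed
  moreover have "sl_path ?n Y"
    unfolding Y_def by (intro sl_path_mult RS(2) 1(3) sl_path_block 2(3))
  moreover have "unit_diag P ?n \<tau>"
    unfolding unit_diag_def
  proof (intro conjI allI impI)
    show "\<tau> \<in> carrier_mat ?n ?n" using \<tau>' \<rho>Y(1) by (auto simp: \<tau>_def)
    show "\<tau> $$ (i,i) \<notin> P" if "i < ?n" for i
      using that 1(4) 2(4) \<tau>' by (cases i) (auto simp: \<tau>_def unit_diag_def)
    show "\<tau> $$ (i,j) \<in> P" if "i < ?n" "j < ?n" "i \<noteq> j" for i j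
      using that 2(4) \<tau>' \<rho>Y ideal_zero[OF I]
      by (cases i; cases j) (auto simp: \<tau>_def unit_diag_def)
  qed
  moreover have "X * A * Y = mat ?n ?n (\<lambda>(i,j). D i * \<tau> $$ (i,j))"
  proof -
    have "X * A * Y = ?X2 * (X1 * B * Y1) * ?Y2"
      unfolding X_def Y_def B_def using X2 Y2 1(1) Y1c Rc Sc Suc.prems
      by (simp add: assoc_mult_mat[of _ ?n ?n _ ?n _ ?n])
    also have "\<dots> = four_block_mat (mat 1 1 (\<lambda>_. a * s)) (a \<cdot>\<^sub>m (\<rho> * Y')) (0\<^sub>m m 1) (X' * A' * Y')"
    proof -
      have "?X2 * (X1 * B * Y1) = four_block_mat (mat 1 1 (\<lambda>_. a * s)) (a \<cdot>\<^sub>m \<rho>) (0\<^sub>m m 1) (X' * A')"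
        unfolding 1(9) using 1(5,7) 2(1)
        by (subst mult_four_block_mat[of _ 1 1 _ m _ m]) auto
      thus ?thesis
        using 1(5,7) 2(1) Y'c
        by (simp, subst mult_four_block_mat[of _ 1 1 _ m _ m]) (auto simp: mult_smult_assoc_mat)
    qed
    also have "\<dots> = mat ?n ?n (\<lambda>(i,j). D i * \<tau> $$ (i,j))" (is "?L = ?M")
    proof (rule eq_matI)
      show "dim_row ?L = dim_row ?M" "dim_col ?L = dim_col ?M" using 2(1) Y'c by auto
      fix i j assume "i < dim_row ?M" "j < dim_col ?M"
      hence ij: "i < ?n" "j < ?n" by auto
      show "?L $$ (i,j) = ?M $$ (i,j)"
        using ij \<rho>Y(1) \<tau>' Y'c 1(5) unfolding 2(5)
        by (cases i; cases j) (auto simp: D_def \<tau>_def)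
    qed
    finally show ?thesis .
  qed
  moreover have "\<forall>i j. i \<le> j \<longrightarrow> j < ?n \<longrightarrow> ldvd P (D i) (D j)"
  proof (intro allI impI)
    fix i j assume ij: "i \<le> j" "j < ?n"
    have "ldvd P a (D' l)" if l: "l < m" for l
    proof -
      have "mat_in {y. ldvd P a y} (X' * A' * Y')"
        using 2(1) 1(7) Y'c
        by (intro mat_in_mult_left[OF ldvd_ideal[OF P], of _ m m _ m]
            mat_in_mult_right[OF ldvd_ideal[OF P], of _ m m _ m] 1(8)) auto
      hence "ldvd P a (D' l * \<tau>' $$ (l,l))" using l unfolding 2(5) mat_in_def by auto
      thus ?thesis using ldvd_cancel[OF P, of "\<tau>' $$ (l,l)"] 2(4) l
        by (simp add: unit_diag_def mult.commute)
    qed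
    thus "ldvd P (D i) (D j)"
      using ij 2(6) ldvd_dvd[OF P, of a a] by (cases i; cases j) (auto simp: D_def)
  qed
  ultimately show ?case by blast
qed

section \<open>Local computation of determinantal divisors\<close>

lemma unit_diag_mult:
  assumes P: "is_maximal P" and M: "unit_diag P n M" and N: "unit_diag P n N"
  shows "unit_diag P n (M * N)"
proof -
  note I = maximal_ideal[OF P]
  have carr: "M \<in> carrier_mat n n" "N \<in> carrier_mat n n" using M N by (auto simp: unit_diag_def)
  have entry: "(M * N) $$ (i,j) = (\<Sum>l=0..<n. M $$ (i,l) * N $$ (l,j))"
    if "i < n" "j < n" for i j
    using carr that by (auto simp: scalar_prod_def)
  have in_P: "M $$ (i,l) * N $$ (l,j) \<in> P"
    if ijl: "i < n" "j < n" "l < n" "i \<noteq> l \<or> l \<noteq> j" for i j l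
  proof -
    have "M $$ (i,l) \<in> P \<or> N $$ (l,j) \<in> P" using M N ijl by (auto simp: unit_diag_def)
    thus ?thesis using ideal_mult_left[OF I] ideal_mult_right[OF I] by blast
  qed
  show ?thesis
    unfolding unit_diag_def
  proof (intro conjI allI impI)
    show "M * N \<in> carrier_mat n n" using carr by simp
    show "(M * N) $$ (i,j) \<in> P" if "i < n" "j < n" "i \<noteq> j" for i j
      unfolding entry[OF that(1,2)] using that by (intro ideal_sum[OF I] in_P) auto
    fix i assume i: "i < n"
    show "(M * N) $$ (i,i) \<notin> P"
    proof
      assume "(M * N) $$ (i,i) \<in> P"
      hence "M $$ (i,i) * N $$ (i,i) + (\<Sum>l\<in>{0..<n} - {i}. M $$ (i,l) * N $$ (l,i)) \<in> P"
        unfolding entry[OF i i] using i by (subst (asm) sum.remove[of _ i]) auto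
      moreover have "(\<Sum>l\<in>{0..<n} - {i}. M $$ (i,l) * N $$ (l,i)) \<in> P"
        using i by (intro ideal_sum[OF I] in_P) auto
      ultimately have "M $$ (i,i) * N $$ (i,i) \<in> P" by (rule ideal_add_cancel[OF I])
      moreover have "M $$ (i,i) \<notin> P" "N $$ (i,i) \<notin> P" using M N i by (auto simp: unit_diag_def)
      ultimately show False using maximal_mult[OF P] by blast
    qed
  qed
qed

lemma unit_diag_transpose: "unit_diag P n M \<Longrightarrow> unit_diag P n (transpose_mat M)"
  unfolding unit_diag_def by auto

lemma mat_cong_one_unit_diag:
  assumes P: "is_maximal P" and M: "M \<in> carrier_mat n n" "mat_cong P M (1\<^sub>m n)"
  shows "unit_diag P n M"
proof -
  note I = maximal_ideal[OF P]
  have diff: "M $$ (i,j) - (if i = j then 1 else 0) \<in> P" if "i < n" "j < n" for i j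
    using M that unfolding mat_cong_def mat_in_def by auto
  show ?thesis
    unfolding unit_diag_def
  proof (intro conjI allI impI M(1))
    show "M $$ (i,j) \<in> P" if "i < n" "j < n" "i \<noteq> j" for i j using diff[OF that(1,2)] that by simp
    fix i assume i: "i < n"
    show "M $$ (i,i) \<notin> P"
    proof
      assume "M $$ (i,i) \<in> P"
      moreover have "M $$ (i,i) - 1 \<in> P" using diff[OF i i] by simp
      ultimately have "M $$ (i,i) - (M $$ (i,i) - 1) \<in> P" by (rule ideal_diff[OF I])
      thus False using maximal_one[OF P] by simp
    qed
  qed
qed

text \<open>
  In the expansion of the determinant every permutation other than the identity picks an off-diagonal
  entry, hence contributes an element of \<open>P\<close>.
\<close>

lemma unit_diag_minor:
  assumes P: "is_maximal P" and M: "unit_diag P n M" and k: "k \<le> n"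
  shows "minor M k (\<lambda>i. i) (\<lambda>i. i) \<notin> P"
proof
  note I = maximal_ideal[OF P]
  let ?t = "\<lambda>p. signof p * (\<Prod>i=0..<k. M $$ (i, p i))"
  assume "minor M k (\<lambda>i. i) (\<lambda>i. i) \<in> P"
  moreover have "minor M k (\<lambda>i. i) (\<lambda>i. i) = ?t id + (\<Sum>p\<in>{p. p permutes {0..<k}} - {id}. ?t p)"
    unfolding minor_sum by (intro sum.remove) (auto simp: finite_permutations permutes_id)
  moreover have "(\<Sum>p\<in>{p. p permutes {0..<k}} - {id}. ?t p) \<in> P"
  proof (rule ideal_sum[OF I])
    fix p assume "p \<in> {p. p permutes {0..<k}} - {id}"
    hence p: "p permutes {0..<k}" "p \<noteq> id" by auto
    then obtain i where i: "p i \<noteq> i" by (auto simp: fun_eq_iff)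
    hence ik: "i < k" using permutes_not_in[OF p(1), of i] by auto
    hence "p i < k" using permutes_in_image[OF p(1), of i] by simp
    hence "M $$ (i, p i) \<in> P" using M i ik k unfolding unit_diag_def by auto
    moreover have "(\<Prod>i=0..<k. M $$ (i, p i)) = M $$ (i, p i) * (\<Prod>i\<in>{0..<k} - {i}. M $$ (i, p i))"
      using ik by (intro prod.remove) auto
    ultimately show "?t p \<in> P" using ideal_mult_left[OF I] ideal_mult_right[OF I] by simp
  qed
  ultimately have "?t id \<in> P" using ideal_add_cancel[OF I, of "?t id"] by simp
  hence "(\<Prod>i=0..<k. M $$ (i, i)) \<in> P" by simp
  thus False using maximal_prod[OF P, of "{0..<k}" "\<lambda>i. M $$ (i, i)"] M k unfolding unit_diag_def by auto
qed

lemma strict_mono_on_ge: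
  assumes f: "strict_mono_on {0..<k} f" and "i < k"
  shows "i \<le> (f i :: nat)"
  using assms(2)
proof (induction i)
  case (Suc i)
  have "f i < f (Suc i)" using f Suc.prems by (intro strict_mono_onD[OF f]) auto
  thus ?case using Suc by simp
qed simp

text \<open>
  The minor of \<open>diag(D) M diag(E)\<close> with rows \<open>f\<close> and columns \<open>g\<close> is the minor of \<open>M\<close> times the products of the
  \<open>D (f i)\<close> and the \<open>E (g i)\<close>. For increasing \<open>f\<close> and \<open>g\<close> these products are locally divisible by those of
  the first \<open>k\<close> terms, and the leading minor attains them up to a unit. The factors \<open>L\<close> and \<open>R\<close> are invertible in
  the local ring, so nothing changes locally when they are removed.
\<close>

lemma det_divisor_local:
  assumes P: "is_maximal P" and k: "k \<le> n"
    and C: "C \<in> carrier_mat n n" and L: "L \<in> carrier_mat n n" "det L \<notin> P"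
    and R: "R \<in> carrier_mat n n" "det R \<notin> P"
    and M: "unit_diag P n M"
    and form: "L * C * R = mat n n (\<lambda>(i,j). D i * M $$ (i,j) * E j)"
    and D: "\<forall>i j. i \<le> j \<longrightarrow> j < n \<longrightarrow> ldvd P (D i) (D j)"
    and E: "\<forall>i j. i \<le> j \<longrightarrow> j < n \<longrightarrow> ldvd P (E i) (E j)"
  shows "det_divisor k C \<subseteq> {x. ldvd P ((\<Prod>i=0..<k. D i) * (\<Prod>i=0..<k. E i)) x}"
    and "(\<Prod>i=0..<k. D i) * (\<Prod>i=0..<k. E i) \<in> sat P (det_divisor k C)"
proof -
  let ?T = "mat n n (\<lambda>(i,j). D i * M $$ (i,j) * E j)"
  let ?\<pi> = "(\<Prod>i=0..<k. D i) * (\<Prod>i=0..<k. E i)"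
  let ?X = "{x. ldvd P ?\<pi> x}"
  let ?i = "\<lambda>i::nat. i"
  have LC: "L * C \<in> carrier_mat n n" using L C by simp
  have X: "is_ideal ?X" by (rule ldvd_ideal[OF P])
  have T: "det_divisor k ?T \<subseteq> ?X"
  proof (rule det_divisor_subsetI[OF _ X])
    show "?T \<in> carrier_mat n n" by simp
    fix f g assume fg: "f \<in> {0..<k} \<rightarrow> {0..<n}" "g \<in> {0..<k} \<rightarrow> {0..<n}"
      "strict_mono_on {0..<k} f" "strict_mono_on {0..<k} g"
    have "ldvd P (\<Prod>i=0..<k. D i) (\<Prod>i=0..<k. D (f i))"
      using strict_mono_on_ge[OF fg(3)] fg(1) by (intro ldvd_prod[OF P] D[rule_format]) (auto simp: Pi_iff)
    moreover have "ldvd P (\<Prod>i=0..<k. E i) (\<Prod>i=0..<k. E (g i))"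
      using strict_mono_on_ge[OF fg(4)] fg(2) by (intro ldvd_prod[OF P] E[rule_format]) (auto simp: Pi_iff)
    ultimately have "(\<Prod>i=0..<k. D (f i)) * (\<Prod>i=0..<k. E (g i)) \<in> ?X"
      using ldvd_mult[OF P] by blast
    hence "minor M k f g * ((\<Prod>i=0..<k. D (f i)) * (\<Prod>i=0..<k. E (g i))) \<in> ?X"
      by (rule ideal_mult_left[OF X])
    moreover have "minor ?T k f g = minor M k f g * ((\<Prod>i=0..<k. D (f i)) * (\<Prod>i=0..<k. E (g i)))"
      by (subst minor_scaled[OF fg(1,2)]) (simp only: mult_ac)
    ultimately show "minor ?T k f g \<in> ?X" by simp
  qed
  show "det_divisor k C \<subseteq> ?X"
  proof (rule det_divisor_subsetI[OF C X])
    fix f g assume fg: "f \<in> {0..<k} \<rightarrow> {0..<n}" "g \<in> {0..<k} \<rightarrow> {0..<n}"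
    let ?c = "det L * det R"
    note adjL = adj_mat[OF L(1)] and adjR = adj_mat[OF R(1)]
    have "adj_mat L * (L * C * R) * adj_mat R = (adj_mat L * L) * C * (R * adj_mat R)"
      using L C R adjL(1) adjR(1) by (simp add: assoc_mult_mat[of _ n n _ n _ n])
    also have "\<dots> = ?c \<cdot>\<^sub>m C"
      unfolding adjL(3) adjR(2) using C
      by (simp add: mult_smult_assoc_mat[of _ n n _ n] mult_smult_distrib[of _ n n _ n])
        (intro eq_matI; simp add: mult_ac)
    finally have eq: "?c \<cdot>\<^sub>m C = adj_mat L * (?T * adj_mat R)"
      unfolding form using adjL(1) adjR(1) by (simp add: assoc_mult_mat[of _ n n _ n _ n])
    have "minor (?c \<cdot>\<^sub>m C) k f g \<in> det_divisor k (?c \<cdot>\<^sub>m C)"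
      by (rule minor_in_det_divisor[OF _ fg]) (use C in simp)
    also have "det_divisor k (?c \<cdot>\<^sub>m C) \<subseteq> det_divisor k (?T * adj_mat R)"
      unfolding eq by (rule det_divisor_mult_right[OF adjL(1)]) (use adjR(1) in auto)
    also have "\<dots> \<subseteq> det_divisor k ?T"
      by (rule det_divisor_mult_left[OF _ adjR(1)]) auto
    also have "\<dots> \<subseteq> ?X" by (rule T)
    finally have "ldvd P ?\<pi> (?c ^ k * minor C k f g)"
      by (simp add: minor_smult[OF C fg])
    thus "minor C k f g \<in> ?X"
      using ldvd_cancel[OF P maximal_power[OF P maximal_mult[OF P L(2) R(2)]]] by blast
  qed
  have i: "?i \<in> {0..<k} \<rightarrow> {0..<n}" using k by auto
  have "minor ?T k ?i ?i \<in> det_divisor k ?T" by (rule minor_in_det_divisor[OF _ i i]) simp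
  also have "\<dots> \<subseteq> det_divisor k (L * C)"
    unfolding form[symmetric] by (rule det_divisor_mult_left[OF LC R(1)])
  also have "\<dots> \<subseteq> det_divisor k C" by (rule det_divisor_mult_right[OF L(1) C])
  also have "minor ?T k ?i ?i = minor M k ?i ?i * ?\<pi>"
    by (subst minor_scaled[OF i i]) (simp only: mult_ac)
  finally show "?\<pi> \<in> sat P (det_divisor k C)"
    using unit_diag_minor[OF P M k] by (auto simp: sat_def)
qed

lemma scaled_rows_mult:
  assumes "M \<in> carrier_mat n n" "N \<in> carrier_mat n n"
  shows "mat n n (\<lambda>(i,j). D i * M $$ (i,j)) * N = mat n n (\<lambda>(i,j). D i * (M * N) $$ (i,j))"
  using assms by (intro eq_matI) (auto simp: scalar_prod_def sum_distrib_left mult.assoc)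

lemma scaled_rows_mult_scaled_cols:
  assumes "M \<in> carrier_mat n n" "N \<in> carrier_mat n n"
  shows "mat n n (\<lambda>(i,j). D i * M $$ (i,j)) * mat n n (\<lambda>(i,j). N $$ (i,j) * E j) =
    mat n n (\<lambda>(i,j). D i * (M * N) $$ (i,j) * E j)"
  using assms
  by (intro eq_matI) (auto simp: scalar_prod_def sum_distrib_left sum_distrib_right mult.assoc)

lemma ideal_prod_ideal:
  assumes "is_ideal I" "is_ideal J"
  shows "is_ideal (ideal_prod class_ring I J)"
  using ring.ideal_prod_is_ideal[OF class_ring.ring_axioms, of I J] assms by (simp add: ideal_class_ring_iff)

lemma ideal_prod_subsetI:
  assumes X: "is_ideal X" and "\<And>i j. i \<in> I \<Longrightarrow> j \<in> J \<Longrightarrow> i * j \<in> X"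
  shows "ideal_prod class_ring I J \<subseteq> X"
proof
  fix x assume "x \<in> ideal_prod class_ring I J"
  thus "x \<in> X" by (induction rule: ideal_prod.induct) (auto simp: assms(2) ideal_add[OF X])
qed

lemma mult_in_ideal_prod: "i \<in> I \<Longrightarrow> j \<in> J \<Longrightarrow> i * j \<in> ideal_prod class_ring I J"
  using ideal_prod.prod[of i I j J class_ring] by simp

lemma sat_whole:
  assumes "is_ideal J" "s \<in> J" "s \<notin> P"
  shows "x \<in> sat P J"
  unfolding sat_def using assms ideal_mult_right[OF assms(1,2)] by blast

text \<open>
  The matrix \<open>W\<close> is the product of the right transformation \<open>Y\<close> that belongs to \<open>A\<close> and the left
  transformation \<open>Z\<close> that belongs to \<open>B\<close>. Every \<open>V\<close> congruent to \<open>Y Z\<close> brings the two diagonal factors next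
  to each other up to a middle matrix that is diagonal modulo \<open>P\<close>.
\<close>

lemma local_det_divisor_product:
  assumes P: "is_maximal (P :: 'a::idom set)" and tot: "\<And>x y. ldvd P x y \<or> ldvd P y x"
    and A: "A \<in> carrier_mat n n" and B: "B \<in> carrier_mat n n"
  shows "\<exists>W. sl_path n W \<and> (\<forall>V\<in>carrier_mat n n. \<forall>k\<le>n. mat_cong P V W \<longrightarrow>
    det_divisor k (A * V * B) \<subseteq> sat P (ideal_prod class_ring (det_divisor k A) (det_divisor k B)) \<and>
    ideal_prod class_ring (det_divisor k A) (det_divisor k B) \<subseteq> sat P (det_divisor k (A * V * B)))"
proof -
  note I = maximal_ideal[OF P]
  let ?T = transpose_mat
  obtain X Y D \<tau> where 1: "X \<in> carrier_mat n n" "det X \<notin> P" "sl_path n Y" "unit_diag P n \<tau>"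
      "X * A * Y = mat n n (\<lambda>(i,j). D i * \<tau> $$ (i,j))"
      "\<forall>i j. i \<le> j \<longrightarrow> j < n \<longrightarrow> ldvd P (D i) (D j)"
    using local_smith_form[OF P tot A] by blast
  have BT: "?T B \<in> carrier_mat n n" using B by simp
  obtain X' Y' E \<sigma> where 2: "X' \<in> carrier_mat n n" "det X' \<notin> P" "sl_path n Y'" "unit_diag P n \<sigma>"
      "X' * ?T B * Y' = mat n n (\<lambda>(i,j). E i * \<sigma> $$ (i,j))"
      "\<forall>i j. i \<le> j \<longrightarrow> j < n \<longrightarrow> ldvd P (E i) (E j)"
    using local_smith_form[OF P tot BT] by blast
  have Y: "Y \<in> carrier_mat n n" "det Y = 1" using 1(3) by (auto simp: sl_path_carrier sl_path_det)
  define Z where "Z = ?T Y'"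
  have Z: "Z \<in> carrier_mat n n" "det Z = 1"
    unfolding Z_def
    by (rule sl_path_carrier[OF sl_path_transpose[OF 2(3)]],
        rule sl_path_det[OF sl_path_transpose[OF 2(3)]])
  have \<tau>: "\<tau> \<in> carrier_mat n n" and \<sigma>: "\<sigma> \<in> carrier_mat n n"
    using 1(4) 2(4) by (auto simp: unit_diag_def)
  have X'T: "?T X' \<in> carrier_mat n n" "det (?T X') \<notin> P"
    using 2(1,2) by (simp_all add: det_transpose[OF 2(1)])
  \<comment> \<open>Transposing the form of the transpose of \<open>B\<close> puts its denominators on the right.\<close>
  have ZBX: "Z * B * ?T X' = mat n n (\<lambda>(i,j). ?T \<sigma> $$ (i,j) * E j)"
  proof -
    have "Z * B * ?T X' = ?T (X' * ?T B * Y')"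
      unfolding Z_def using 2(1) BT B sl_path_carrier[OF 2(3)]
      by (simp add: transpose_mult[of _ n n _ n] assoc_mult_mat[of _ n n _ n _ n])
    also have "\<dots> = mat n n (\<lambda>(i,j). ?T \<sigma> $$ (i,j) * E j)"
      unfolding 2(5) using \<sigma> by (intro eq_matI) (auto simp: mult.commute)
    finally show ?thesis .
  qed
  have local: "det_divisor k (A * V * B) \<subseteq> sat P (ideal_prod class_ring (det_divisor k A) (det_divisor k B))"
      (is "?J \<subseteq> sat P ?K")
    "ideal_prod class_ring (det_divisor k A) (det_divisor k B) \<subseteq> sat P (det_divisor k (A * V * B))"
    if V: "V \<in> carrier_mat n n" "mat_cong P V (Y * Z)" and k: "k \<le> n" for V k
  proof -
    let ?J = "det_divisor k (A * V * B)"
    let ?K = "ideal_prod class_ring (det_divisor k A) (det_divisor k B)"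
    let ?\<pi> = "\<Prod>i=0..<k. D i" and ?\<rho> = "\<Prod>i=0..<k. E i"
    note adjY = adj_mat[OF Y(1), unfolded Y(2)] and adjZ = adj_mat[OF Z(1), unfolded Z(2)]
    \<comment> \<open>The adjugates are inverses here, since \<open>Y\<close> and \<open>Z\<close> have determinant one.\<close>
    define \<Theta> where "\<Theta> = adj_mat Y * V * adj_mat Z"
    have \<Theta>: "\<Theta> \<in> carrier_mat n n" using adjY(1) adjZ(1) V(1) by (simp add: \<Theta>_def)
    have one: "1 \<cdot>\<^sub>m 1\<^sub>m n = (1\<^sub>m n :: 'a mat)" by (intro eq_matI) auto
    have YZ: "Y * Z \<in> carrier_mat n n" using Y Z by simp
    have "mat_cong P \<Theta> (adj_mat Y * (Y * Z) * adj_mat Z)"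
      unfolding \<Theta>_def
      by (intro mat_cong_mult[OF I, of _ n n _ _ n]) (use adjY(1) adjZ(1) V YZ mat_cong_refl[OF I] in auto)
    also have "adj_mat Y * (Y * Z) * adj_mat Z = (adj_mat Y * Y) * (Z * adj_mat Z)"
      using Y(1) Z(1) adjY(1) adjZ(1) by (simp add: assoc_mult_mat[of _ n n _ n _ n])
    also have "\<dots> = 1\<^sub>m n" unfolding adjY(3) adjZ(2) one by simp
    finally have \<Theta>u: "unit_diag P n \<Theta>" by (rule mat_cong_one_unit_diag[OF P \<Theta>])
    have V_eq: "V = Y * \<Theta> * Z"
    proof -
      have "Y * \<Theta> * Z = (Y * adj_mat Y) * V * (adj_mat Z * Z)"
        unfolding \<Theta>_def using Y(1) Z(1) adjY(1) adjZ(1) V(1)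
        by (simp add: assoc_mult_mat[of _ n n _ n _ n])
      thus ?thesis unfolding adjY(2) adjZ(3) one using V(1) by simp
    qed
    have "X * (A * V * B) * ?T X' = (X * A * Y) * \<Theta> * (Z * B * ?T X')"
      unfolding V_eq using 1(1) A B Y(1) Z(1) \<Theta> X'T(1)
      by (simp add: assoc_mult_mat[of _ n n _ n _ n])
    also have "\<dots> = mat n n (\<lambda>(i,j). D i * (\<tau> * \<Theta> * ?T \<sigma>) $$ (i,j) * E j)"
      unfolding 1(5) ZBX scaled_rows_mult[OF \<tau> \<Theta>]
      by (rule scaled_rows_mult_scaled_cols) (use \<tau> \<Theta> \<sigma> in auto)
    finally have form: "X * (A * V * B) * ?T X' =
        mat n n (\<lambda>(i,j). D i * (\<tau> * \<Theta> * ?T \<sigma>) $$ (i,j) * E j)" .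
    have AVB: "A * V * B \<in> carrier_mat n n" using A V B by simp
    have "unit_diag P n (\<tau> * \<Theta> * ?T \<sigma>)"
      by (intro unit_diag_mult[OF P] unit_diag_transpose 1(4) 2(4) \<Theta>u)
    note J = det_divisor_local[OF P k AVB 1(1,2) X'T this form 1(6) 2(6)]
    have "X * A * Y = mat n n (\<lambda>(i,j). D i * \<tau> $$ (i,j) * (\<lambda>_. 1) j)"
      using 1(5) by simp
    \<comment> \<open>\<open>A\<close> itself is the case of a constant chain on the right.\<close>
    note a = det_divisor_local[OF P k A 1(1,2) Y(1) _ 1(4) this 1(6), rotated]
    have "X' * ?T B * Y' = mat n n (\<lambda>(i,j). E i * \<sigma> $$ (i,j) * (\<lambda>_. 1) j)"
      using 2(5) by simp
    note b = det_divisor_local[OF P k BT 2(1,2) sl_path_carrier[OF 2(3)] _ 2(4) this 2(6), rotated]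
    have "\<forall>i j. i \<le> j \<longrightarrow> j < n \<longrightarrow> ldvd P ((\<lambda>_. 1) i) ((\<lambda>_. 1) j)"
      using ldvd_dvd[OF P] by simp
    note a = a[OF this] and b = b[OF this]
    have one_notin: "det Y \<notin> P" "det Y' \<notin> P"
      using maximal_one[OF P] sl_path_det[OF 1(3)] sl_path_det[OF 2(3)] by simp_all
    have a_dvd: "ldvd P ?\<pi> x" if "x \<in> det_divisor k A" for x
      using a(1)[OF one_notin(1)] that by (auto simp: subset_iff)
    have a_in: "?\<pi> \<in> sat P (det_divisor k A)"
      using a(2)[OF one_notin(1)] by auto
    have b_dvd: "ldvd P ?\<rho> x" if "x \<in> det_divisor k B" for x
      using b(1)[OF one_notin(2)] that by (auto simp: subset_iff det_divisor_transpose[OF B])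
    have b_in: "?\<rho> \<in> sat P (det_divisor k B)"
      using b(2)[OF one_notin(2)] by (auto simp: det_divisor_transpose[OF B])
    have K: "is_ideal ?K" by (intro ideal_prod_ideal det_divisor_ideal)
    obtain s t where st: "s \<notin> P" "s * ?\<pi> \<in> det_divisor k A" "t \<notin> P" "t * ?\<rho> \<in> det_divisor k B"
      using a_in b_in by (auto simp: sat_def)
    have "(s * ?\<pi>) * (t * ?\<rho>) \<in> ?K" using st by (intro mult_in_ideal_prod)
    moreover have "(s * ?\<pi>) * (t * ?\<rho>) = (s * t) * (?\<pi> * ?\<rho>)" by (simp only: mult_ac)
    ultimately have K_in: "?\<pi> * ?\<rho> \<in> sat P ?K"
      using maximal_mult[OF P st(1,3)] by (auto simp: sat_def)
    show "?J \<subseteq> sat P ?K"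
      using J(1) sat_memI[OF P K _ K_in] by (auto simp: ldvd_def)
    show "?K \<subseteq> sat P ?J"
    proof (rule ideal_prod_subsetI[OF sat_ideal[OF P det_divisor_ideal]])
      fix i j assume "i \<in> det_divisor k A" "j \<in> det_divisor k B"
      hence "ldvd P (?\<pi> * ?\<rho>) (i * j)" by (intro ldvd_mult[OF P] a_dvd b_dvd)
      thus "i * j \<in> sat P ?J"
        using sat_memI[OF P det_divisor_ideal _ J(2)] by (simp add: ldvd_def)
    qed
  qed
  have "sl_path n (Y * Z)"
    unfolding Z_def by (intro sl_path_mult sl_path_transpose 1(3) 2(3))
  thus ?thesis using local by blast
qed

section \<open>Matrices with multiplicative determinantal divisors\<close>

theorem theorem4p2:
  fixes n :: nat and \<aa> \<bb> :: "nat \<Rightarrow> 'a::idom set"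
  assumes "dedekind_domain TYPE('a)"
    and "n \<ge> 1"
    and "\<And>k. k \<in> {1..n} \<Longrightarrow> ideal (\<aa> k) class_ring"
    and "\<And>k. k \<in> {1..n} \<Longrightarrow> ideal (\<bb> k) class_ring"
    and "\<exists>A \<in> nonsingular_mats n. \<exists>B \<in> nonsingular_mats n.
           \<forall>k \<in> {1..n}. det_divisor k A = \<aa> k \<and> det_divisor k B = \<bb> k"
  shows "\<exists>A' \<in> nonsingular_mats n. \<exists>B' \<in> nonsingular_mats n.
           \<forall>k \<in> {1..n}.
             det_divisor k A' = \<aa> k \<and>
             det_divisor k B' = \<bb> k \<and>
             det_divisor k (A' * B') = ideal_prod class_ring (\<aa> k) (\<bb> k)"
proof -
  note ded = assms(1)
  have noeth: "noetherian_domain (class_ring :: 'a ring)"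
    using ded by (simp add: dedekind_domain_def)
  obtain A B where A: "A \<in> carrier_mat n n" "det A \<noteq> 0" and B: "B \<in> carrier_mat n n" "det B \<noteq> 0"
    and ab: "\<And>k. k \<in> {1..n} \<Longrightarrow> det_divisor k A = \<aa> k \<and> det_divisor k B = \<bb> k"
    using assms(5) unfolding nonsingular_mats_def by blast
  let ?K = "\<lambda>k. ideal_prod class_ring (det_divisor k A) (det_divisor k B)"
  define d where "d = det A * det B"
  have d: "d \<noteq> 0" using A B by (simp add: d_def)
  \<comment> \<open>At the maximal ideals outside \<open>S\<close> every determinantal divisor involved contains a unit.\<close>
  define S where "S = {P. is_maximal P \<and> d \<in> P}"
  have fin: "finite S" unfolding S_def by (rule finite_maximal_ideals_containing[OF ded d])
  have max: "is_maximal P" if "P \<in> S" for P using that by (simp add: S_def)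
  define good where "good = (\<lambda>P W. sl_path n W \<and> (\<forall>V\<in>carrier_mat n n. \<forall>k\<le>n. mat_cong P V W \<longrightarrow>
      det_divisor k (A * V * B) \<subseteq> sat P (?K k) \<and> ?K k \<subseteq> sat P (det_divisor k (A * V * B))))"
  have "\<exists>W. good P W" if "P \<in> S" for P
  proof -
    have P: "is_maximal P" "P \<noteq> {0}" using that d by (auto simp: S_def)
    have "ldvd P x y \<or> ldvd P y x" for x y by (rule ldvd_total[OF ded P])
    from local_det_divisor_product[OF P(1) this A(1) B(1)] show ?thesis unfolding good_def .
  qed
  then obtain W where W: "\<And>P. P \<in> S \<Longrightarrow> good P (W P)" by metis
  have "\<exists>V \<in> carrier_mat n n. det V = 1 \<and> (\<forall>P\<in>S. mat_cong P V (W P))"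
    by (rule sl_path_simultaneous[OF fin max]) (use W in \<open>auto simp: good_def\<close>)
  then obtain V where V: "V \<in> carrier_mat n n" "det V = 1" "\<And>P. P \<in> S \<Longrightarrow> mat_cong P V (W P)"
    by blast
  have AV: "A * V \<in> carrier_mat n n" using A V by simp
  have AVB: "A * V * B \<in> carrier_mat n n" using AV B by simp
  have detAV: "det (A * V) = det A" using A V by (simp add: det_mult[of _ n])
  have detAVB: "det (A * V * B) = d" using AV B detAV by (simp add: det_mult[of _ n] d_def)
  have dAV: "det_divisor k (A * V) = det_divisor k A" for k
  proof
    show "det_divisor k (A * V) \<subseteq> det_divisor k A" by (rule det_divisor_mult_left[OF A(1) V(1)])
    note adj = adj_mat[OF V(1), unfolded V(2)]
    have "A = A * V * adj_mat V"
    proof -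
      have "A * V * adj_mat V = A * (V * adj_mat V)" using A V adj(1) by simp
      also have "\<dots> = A" unfolding adj(2) using A(1) by (simp add: mult_smult_distrib[of _ n n _ n])
         (intro eq_matI; simp)
      finally show ?thesis by simp
    qed
    thus "det_divisor k A \<subseteq> det_divisor k (A * V)"
      using det_divisor_mult_left[OF AV adj(1), of k] by simp
  qed
  have main: "det_divisor k (A * V * B) = ?K k" if k: "k \<in> {1..n}" for k
  proof -
    let ?J = "det_divisor k (A * V * B)"
    have kn: "k \<le> n" using k by simp
    have J: "is_ideal ?J" by (rule det_divisor_ideal)
    have K: "is_ideal (?K k)" by (intro ideal_prod_ideal det_divisor_ideal)
    have loc: "?J \<subseteq> sat P (?K k) \<and> ?K k \<subseteq> sat P ?J" if P: "is_maximal P" for P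
    proof (cases "d \<in> P")
      case True
      hence "P \<in> S" using P by (simp add: S_def)
      thus ?thesis using W[of P] V kn unfolding good_def by blast
    next
      case False
      have dk: "d ^ k \<notin> P" by (rule maximal_power[OF P False])
      have "d ^ k \<in> ?J" using det_power_in_det_divisor[OF AVB kn] detAVB by simp
      moreover have "d ^ k \<in> ?K k"
        unfolding d_def power_mult_distrib
        by (intro mult_in_ideal_prod det_power_in_det_divisor[OF A(1) kn] det_power_in_det_divisor[OF B(1) kn])
      ultimately show ?thesis using sat_whole[OF J _ dk] sat_whole[OF K _ dk] by blast
    qed
    show ?thesis
    proof
      show "?J \<subseteq> ?K k" by (rule local_global[OF noeth K]) (simp add: loc)
      show "?K k \<subseteq> ?J" by (rule local_global[OF noeth J]) (simp add: loc)
    qed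
  qed
  show ?thesis
  proof (intro bexI ballI conjI)
    fix k assume k: "k \<in> {1..n}"
    show "det_divisor k (A * V) = \<aa> k" "det_divisor k B = \<bb> k"
      using dAV ab[OF k] by simp_all
    show "det_divisor k (A * V * B) = ideal_prod class_ring (\<aa> k) (\<bb> k)"
      using main[OF k] ab[OF k] by simp
  next
    show "A * V \<in> nonsingular_mats n" "B \<in> nonsingular_mats n"
      using A B AV detAV by (simp_all add: nonsingular_mats_def)
  qed
qed

end
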